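(* Let $\Gamma$ be a locally finite connected graph and let $\{\xi_i\}_{i=1}^\infty$ be a sequence of i.i.d. random $\Gamma$-elements. Assume that the weight function $M_{\xi_1}$ is totally defined and $\mathbb{E}(\xi_1)=\{v_1,\dots,v_k\}$ (distinct vertices), where $k\ge 4$. If the random walk $\overline{R}^1$ associated to $v_1$ is genuinely $(k-1)$-dimensional, then $$\limsup_{n\to\infty}\mathbb{S}_n=\mathbb{E}(\xi_1)$$ holds with probability one.
   Context: Let $(\Omega,\mathcal{F},\mathbf{P})$ be a probability space and let $d$ be the graph distance on $V(\Gamma)$. A random $\Gamma$-element is a measurable function $\xi:\Omega\to V(\Gamma)$ (with $V(\Gamma)$ discrete); its distribution is $\mu_\xi(v)=\mathbf{P}(\xi=v)$. The weight function is $M_\xi(v)=\sum_{s\in V(\Gamma)}d^2(v,s)\mu_\xi(s)$; it is totally defined if $M_\xi(v)<\infty$ for all $v\in V(\Gamma)$. In that case the mean-set of $\xi$ is $\mathbb{E}(\xi)=\{v\in V(\Gamma)\mid M_\xi(v)\le M_\xi(u)\ \forall u\in V(\Gamma)\}$. For a sample $\xi_1,\dots,\xi_n$ put $\mu_n(u)=\frac1n|\{i\mid 1\le i\le n,\ \xi_i=u\}|$ and $M_n(v)=\sum_{s\in V(\Gamma)}d^2(v,s)\mu_n(s)$. The sample mean-set is $\mathbb{S}_n=\mathbb{S}(\xi_1,\dots,\xi_n)=\{v\in V(\Gamma)\mid M_n(v)\le M_n(u)\ \forall u\in V(\Gamma)\}$. For a sequence of sets, $\limsup_n A_n$ is the set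 of points lying in $A_n$ for infinitely many $n$. The random walk $\overline{R}^1$ associated to $v_1$ is the random walk on $\mathbb{Z}^{k-1}$ starting at the origin whose $n$-th increment is $\overline{\zeta}(\xi_n)$, where $\overline{\zeta}(s)=(d^2(v_2,s)-d^2(v_1,s),\dots,d^2(v_k,s)-d^2(v_1,s))$ for $s\in V(\Gamma)$. Let $A_{\overline{R}^1}\subseteq\mathbb{Z}^{k-1}$ be the subgroup generated by the increments having positive probability, i.e. by $\{\overline{\zeta}(s)\mid \mu_{\xi_1}(s)>0\}$. The walk is genuinely $m$-dimensional if $A_{\overline{R}^1}\cong\mathbb{Z}^m$. *)

theory Defs
  imports "HOL-Probability.Probability" "HOL-Algebra.Product_Groups"
begin

text \<open>Undirected graphs with vertex set \<open>V\<close>; an edge is an unordered pair \<open>{u, v}\<close> of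
  vertices. A loop \<open>{v}\<close> is permitted (it does not affect distances).\<close>

definition graph :: "'v set \<Rightarrow> 'v set set \<Rightarrow> bool" where
  "graph V E \<longleftrightarrow> (\<forall>e\<in>E. \<exists>u\<in>V. \<exists>v\<in>V. e = {u, v})"

definition locally_finite :: "'v set \<Rightarrow> 'v set set \<Rightarrow> bool" where
  "locally_finite V E \<longleftrightarrow> (\<forall>v\<in>V. finite {e \<in> E. v \<in> e})"

definition adjacency :: "'v set \<Rightarrow> 'v set set \<Rightarrow> ('v \<times> 'v) set" where
  "adjacency V E = {(u, v). u \<in> V \<and> v \<in> V \<and> {u, v} \<in> E}"

definition graph_connected :: "'v set \<Rightarrow> 'v set set \<Rightarrow> bool" where
  "graph_connected V E \<longleftrightarrow> (\<forall>u\<in>V. \<forall>v\<in>V. (u, v) \<in> (adjacency V E)\<^sup>*)"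

text \<open>\<open>(u, v) \<in> adjacency V E ^^ n\<close> says that there is a walk of length \<open>n\<close> from \<open>u\<close> to \<open>v\<close>;
  the distance is only meaningful when some walk exists.\<close>

definition graph_dist :: "'v set \<Rightarrow> 'v set set \<Rightarrow> 'v \<Rightarrow> 'v \<Rightarrow> nat" where
  "graph_dist V E u v = (LEAST n. (u, v) \<in> adjacency V E ^^ n)"

definition distribution_of :: "'w measure \<Rightarrow> ('w \<Rightarrow> 'v) \<Rightarrow> 'v \<Rightarrow> real" where
  "distribution_of P X v = measure P {\<omega> \<in> space P. X \<omega> = v}"

text \<open>The weight is an unconditional sum of nonnegative terms with values in \<open>[0, \<infinity>]\<close>.\<close>

definition weight :: "'v set \<Rightarrow> 'v set set \<Rightarrow> ('v \<Rightarrow> real) \<Rightarrow> 'v \<Rightarrow> ennreal" where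
  "weight V E \<mu> v = (\<Sum>\<^sub>\<infinity>s\<in>V. ennreal ((real (graph_dist V E v s))\<^sup>2 * \<mu> s))"

definition weight_totally_defined :: "'v set \<Rightarrow> 'v set set \<Rightarrow> ('v \<Rightarrow> real) \<Rightarrow> bool" where
  "weight_totally_defined V E \<mu> \<longleftrightarrow> (\<forall>v\<in>V. weight V E \<mu> v < \<infinity>)"

definition mean_set :: "'v set \<Rightarrow> 'v set set \<Rightarrow> ('v \<Rightarrow> real) \<Rightarrow> 'v set" where
  "mean_set V E \<mu> = {v \<in> V. \<forall>u\<in>V. weight V E \<mu> v \<le> weight V E \<mu> u}"

text \<open>A sample of size \<open>n\<close> consists of the values \<open>x 1, \<dots>, x n\<close>.\<close>

definition sample_freq :: "(nat \<Rightarrow> 'v) \<Rightarrow> nat \<Rightarrow> 'v \<Rightarrow> real" where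
  "sample_freq x n u = 1 / real n * real (card {i \<in> {1..n}. x i = u})"

definition sample_mean_set :: "'v set \<Rightarrow> 'v set set \<Rightarrow> (nat \<Rightarrow> 'v) \<Rightarrow> nat \<Rightarrow> 'v set" where
  "sample_mean_set V E x n = mean_set V E (sample_freq x n)"

definition int_power_group :: "nat \<Rightarrow> (nat \<Rightarrow> int) monoid" where
  "int_power_group m = product_group {1..m} (\<lambda>_. integer_group)"

text \<open>The increment map of the random walk on \<open>\<int>\<^sup>k\<^sup>-\<^sup>1\<close> associated to \<open>v 1\<close>: its \<open>n\<close>-th increment
  is \<open>walk_increment V E v k (\<xi> n \<omega>)\<close>, where \<open>v 1, \<dots>, v k\<close> enumerate the mean-set. The
  \<open>j\<close>-th coordinate, \<open>1 \<le> j \<le> k - 1\<close>, compares \<open>v (j + 1)\<close> with \<open>v 1\<close>.\<close>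

definition walk_increment ::
    "'v set \<Rightarrow> 'v set set \<Rightarrow> (nat \<Rightarrow> 'v) \<Rightarrow> nat \<Rightarrow> 'v \<Rightarrow> (nat \<Rightarrow> int)" where
  "walk_increment V E v k s =
     (\<lambda>j\<in>{1..k - 1}. (int (graph_dist V E (v (j + 1)) s))\<^sup>2 - (int (graph_dist V E (v 1) s))\<^sup>2)"

text \<open>The subgroup of \<open>\<int>\<^sup>k\<^sup>-\<^sup>1\<close> generated by the increments of positive probability, when the
  steps of the walk are driven by vertices with distribution \<open>\<mu>\<close>.\<close>

definition walk_group ::
    "'v set \<Rightarrow> 'v set set \<Rightarrow> (nat \<Rightarrow> 'v) \<Rightarrow> nat \<Rightarrow> ('v \<Rightarrow> real) \<Rightarrow> (nat \<Rightarrow> int) monoid" where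
  "walk_group V E v k \<mu> =
     subgroup_generated (int_power_group (k - 1)) (walk_increment V E v k ` {s \<in> V. \<mu> s > 0})"

definition walk_genuinely_dimensional ::
    "'v set \<Rightarrow> 'v set set \<Rightarrow> (nat \<Rightarrow> 'v) \<Rightarrow> nat \<Rightarrow> ('v \<Rightarrow> real) \<Rightarrow> nat \<Rightarrow> bool" where
  "walk_genuinely_dimensional V E v k \<mu> m \<longleftrightarrow> walk_group V E v k \<mu> \<cong> int_power_group m"

end

theory Submission
  imports Defs "HOL-Library.Discrete_Functions" "Jordan_Normal_Form.Determinant"
begin

text \<open>
  Write \<open>D u s\<close> for the squared distance from \<open>u\<close> to \<open>s\<close>. Up to normalisation the sample
  weight of \<open>u\<close> is \<open>D u (\<xi> 1) + \<dots> + D u (\<xi> n)\<close>, so which vertex minimises it is decided by sums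
  of the i.i.d. variables \<open>D u (\<xi> i) - D x (\<xi> i)\<close>. A finite second moment of the distance makes
  these differences square-integrable, since \<open>D u s - D x s\<close> grows only linearly with the distance
  from \<open>x\<close> to \<open>s\<close>. Hence second-moment arguments suffice throughout.

  No vertex outside the mean-set lies in infinitely many sample mean-sets. For a single such vertex
  this is the law of large numbers. All vertices far from a mean vertex \<open>x\<close> are excluded at once by
  the inequality \<open>D u s - D x s \<ge> a * (a - 2 * t)\<close>, where \<open>a\<close> and \<open>t\<close> are the distances from \<open>x\<close> to
  \<open>u\<close> and to \<open>s\<close>: its sample average is positive as soon as \<open>a\<close> exceeds twice the average of \<open>t\<close>.
  Only the finitely many vertices of a ball remain (\<open>AE_eventually_mean_set_beats_others\<close>).

  Conversely, each mean vertex \<open>v j\<close> must win infinitely often against the other mean vertices, that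
  is, the centred random walk with increments \<open>D (v i) (\<xi> n) - D (v j) (\<xi> n)\<close>, \<open>i \<noteq> j\<close>, must visit
  the positive orthant infinitely often. A multidimensional central limit theorem would give a
  positive lower bound for the probability of being in the orthant at time \<open>n\<close>. The same bound
  follows by a change of measure: if \<open>\<theta>\<close> is bounded and centred and has correlation \<open>1\<close> with every
  coordinate of the increment, then the density \<open>\<Prod>i\<le>n. (1 + \<epsilon> * \<theta> (\<xi> i) / sqrt n)\<close> moves the mean of
  every coordinate of the walk to \<open>\<epsilon> * sqrt n\<close> without increasing the order of its variance. By
  Chebyshev's inequality the orthant is likely under the new measure, and because the second moment
  of the density stays bounded in \<open>n\<close>, its original probability cannot be small
  (\<open>tilting_lower_bound\<close>). Kolmogorov's 0-1 law turns the positive probability into an almost sure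
  statement (\<open>AE_frequently_all_sums_nonneg\<close>).

  The function \<open>\<theta>\<close> comes from genuine dimensionality. A subgroup of \<open>\<int>\<^sup>m\<close> that is isomorphic to
  \<open>\<int>\<^sup>m\<close> has full rank, so the increments of positive probability span \<open>\<real>\<^sup>m\<close>
  (\<open>genuinely_dimensional_imp_increments_span\<close>). If a target vector is \<open>\<Sum>s. c s * \<zeta> s\<close>, with \<open>\<zeta> s\<close>
  the increment caused by \<open>s\<close>, then \<open>\<theta> = \<Sum>s. c s / \<mu> s * (1\<^sub>s - \<mu> s)\<close>, with \<open>1\<^sub>s\<close> the indicator of
  \<open>s\<close>, has this vector as its vector of correlations (\<open>centred_indicator_combination\<close>).
\<close>

section \<open>Moments of independent identically distributed sequences\<close>

locale iid_sequence = prob_space P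
  for P :: "'w measure" +
  fixes N :: "'a measure" and X :: "nat \<Rightarrow> 'w \<Rightarrow> 'a"
  assumes indep: "indep_vars (\<lambda>_. N) X {1..}"
    and ident: "\<And>i. i \<ge> 1 \<Longrightarrow> distr P N (X i) = distr P N (X 1)"
begin

(* keeps the reference variable in the form X 1, as in the assumptions of the locale *)
declare One_nat_def [simp del]

lemma X_measurable [measurable]: "i \<ge> 1 \<Longrightarrow> X i \<in> measurable P N"
  using indep by (auto simp: indep_vars_def)

lemma X_1_measurable [measurable]: "X 1 \<in> measurable P N"
  by (rule X_measurable) simp

lemma integrable_ident:
  fixes f :: "'a \<Rightarrow> real"
  assumes [measurable]: "f \<in> borel_measurable N" and i: "i \<ge> 1"
  shows "integrable P (\<lambda>\<omega>. f (X i \<omega>)) \<longleftrightarrow> integrable P (\<lambda>\<omega>. f (X 1 \<omega>))"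
  using integrable_distr_eq[OF X_measurable[OF i] assms(1)]
    integrable_distr_eq[OF X_1_measurable assms(1)] ident[OF i] by simp

lemma expectation_ident:
  fixes f :: "'a \<Rightarrow> real"
  assumes [measurable]: "f \<in> borel_measurable N" and i: "i \<ge> 1"
  shows "expectation (\<lambda>\<omega>. f (X i \<omega>)) = expectation (\<lambda>\<omega>. f (X 1 \<omega>))"
  using integral_distr[OF X_measurable[OF i] assms(1)]
    integral_distr[OF X_1_measurable assms(1)] ident[OF i] by simp

lemma
  fixes f :: "nat \<Rightarrow> 'a \<Rightarrow> real"
  assumes I: "finite I" "I \<subseteq> {1..}"
    and f: "\<And>i. i \<in> I \<Longrightarrow> f i \<in> borel_measurable N"
    and int: "\<And>i. i \<in> I \<Longrightarrow> integrable P (\<lambda>\<omega>. f i (X 1 \<omega>))"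
  shows expectation_prod:
      "expectation (\<lambda>\<omega>. \<Prod>i\<in>I. f i (X i \<omega>)) = (\<Prod>i\<in>I. expectation (\<lambda>\<omega>. f i (X 1 \<omega>)))"
    and integrable_prod: "integrable P (\<lambda>\<omega>. \<Prod>i\<in>I. f i (X i \<omega>))"
proof -
  have ind: "indep_vars (\<lambda>_. borel) (\<lambda>i \<omega>. f i (X i \<omega>)) I"
    by (rule indep_vars_compose2[OF indep_vars_subset[OF indep I(2)]]) (use f in auto)
  have int': "integrable P (\<lambda>\<omega>. f i (X i \<omega>))" if "i \<in> I" for i
    using integrable_ident[OF f[OF that], of i] int[OF that] I that by auto
  show "integrable P (\<lambda>\<omega>. \<Prod>i\<in>I. f i (X i \<omega>))"
    by (rule indep_vars_integrable[OF I(1) ind int'])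
  have "expectation (\<lambda>\<omega>. \<Prod>i\<in>I. f i (X i \<omega>)) = (\<Prod>i\<in>I. expectation (\<lambda>\<omega>. f i (X i \<omega>)))"
    by (rule indep_vars_lebesgue_integral[OF I(1) ind int'])
  also have "\<dots> = (\<Prod>i\<in>I. expectation (\<lambda>\<omega>. f i (X 1 \<omega>)))"
    by (intro prod.cong refl expectation_ident f) (use I in auto)
  finally show "expectation (\<lambda>\<omega>. \<Prod>i\<in>I. f i (X i \<omega>)) = (\<Prod>i\<in>I. expectation (\<lambda>\<omega>. f i (X 1 \<omega>)))" .
qed

text \<open>For a density \<open>w\<close> of total mass 1, the product of the \<open>w (X i)\<close> is the density of a measure under
  which the variables \<open>X i\<close> are again independent and identically distributed. Read in this way, the
  lemma says that the variance of a sum of \<open>n\<close> centred independent variables is \<open>n\<close> times the variance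
  of one of them. The constant density gives the original measure.\<close>

lemma
  fixes w g :: "'a \<Rightarrow> real"
  assumes [measurable]: "w \<in> borel_measurable N" "g \<in> borel_measurable N"
    and int: "integrable P (\<lambda>\<omega>. w (X 1 \<omega>))" "integrable P (\<lambda>\<omega>. w (X 1 \<omega>) * g (X 1 \<omega>))"
      "integrable P (\<lambda>\<omega>. w (X 1 \<omega>) * (g (X 1 \<omega>))\<^sup>2)"
    and mass: "expectation (\<lambda>\<omega>. w (X 1 \<omega>)) = 1"
    and mean: "expectation (\<lambda>\<omega>. w (X 1 \<omega>) * g (X 1 \<omega>)) = 0"
  shows weighted_second_moment:
      "expectation (\<lambda>\<omega>. (\<Prod>i=1..n. w (X i \<omega>)) * (\<Sum>i=1..n. g (X i \<omega>))\<^sup>2)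
        = real n * expectation (\<lambda>\<omega>. w (X 1 \<omega>) * (g (X 1 \<omega>))\<^sup>2)"
    and integrable_weighted_square:
      "integrable P (\<lambda>\<omega>. (\<Prod>i=1..n. w (X i \<omega>)) * (\<Sum>i=1..n. g (X i \<omega>))\<^sup>2)"
proof -
  let ?I = "{1..n}"
  \<comment> \<open>Expanding the square gives one summand for each pair of indices; each is a product
    over the single variables, with an additional factor at the indices \<open>a\<close> and
    \<open>b\<close>.\<close>
  define h where "h a b i x = w x * (if i = a then g x else 1) * (if i = b then g x else 1)"
    for a b i :: nat and x
  have h_meas: "h a b i \<in> borel_measurable N" for a b i
    unfolding h_def by measurable
  have h_int: "integrable P (\<lambda>\<omega>. h a b i (X 1 \<omega>))" for a b i
    using int by (cases "i = a"; cases "i = b") (auto simp: h_def power2_eq_square mult.assoc)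
  have expand: "(\<Prod>i\<in>?I. w (X i \<omega>)) * (\<Sum>i\<in>?I. g (X i \<omega>))\<^sup>2
      = (\<Sum>a\<in>?I. \<Sum>b\<in>?I. \<Prod>i\<in>?I. h a b i (X i \<omega>))" for \<omega>
  proof -
    have "(\<Prod>i\<in>?I. h a b i (X i \<omega>)) = (\<Prod>i\<in>?I. w (X i \<omega>)) * (g (X a \<omega>) * g (X b \<omega>))"
      if "a \<in> ?I" "b \<in> ?I" for a b
      using that by (simp add: h_def prod.distrib mult.assoc)
    then show ?thesis
      unfolding power2_eq_square sum_product by (simp add: sum_distrib_left)
  qed
  have int_ab: "integrable P (\<lambda>\<omega>. \<Prod>i\<in>?I. h a b i (X i \<omega>))" for a b
    by (rule integrable_prod) (auto intro: h_meas h_int)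
  have E_ab: "expectation (\<lambda>\<omega>. \<Prod>i\<in>?I. h a b i (X i \<omega>))
      = (if a = b then expectation (\<lambda>\<omega>. w (X 1 \<omega>) * (g (X 1 \<omega>))\<^sup>2) else 0)"
    if ab: "a \<in> ?I" "b \<in> ?I" for a b
  proof -
    have eq: "expectation (\<lambda>\<omega>. \<Prod>i\<in>?I. h a b i (X i \<omega>)) = (\<Prod>i\<in>?I. expectation (\<lambda>\<omega>. h a b i (X 1 \<omega>)))"
      by (rule expectation_prod) (auto intro: h_meas h_int)
    show ?thesis
    proof (cases "a = b")
      case True
      have "(\<Prod>i\<in>?I. expectation (\<lambda>\<omega>. h a b i (X 1 \<omega>)))
          = (\<Prod>i\<in>?I. if i = a then expectation (\<lambda>\<omega>. w (X 1 \<omega>) * (g (X 1 \<omega>))\<^sup>2) else 1)"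
        by (intro prod.cong refl) (use True mass in \<open>auto simp: h_def power2_eq_square mult.assoc\<close>)
      with eq True ab show ?thesis by simp
    next
      case False
      have "expectation (\<lambda>\<omega>. h a b a (X 1 \<omega>)) = 0"
        using False mean by (simp add: h_def)
      with eq False ab show ?thesis by (auto intro!: prod_zero)
    qed
  qed
  show "integrable P (\<lambda>\<omega>. (\<Prod>i=1..n. w (X i \<omega>)) * (\<Sum>i=1..n. g (X i \<omega>))\<^sup>2)"
    unfolding expand by (intro Bochner_Integration.integrable_sum int_ab)
  have "expectation (\<lambda>\<omega>. (\<Prod>i=1..n. w (X i \<omega>)) * (\<Sum>i=1..n. g (X i \<omega>))\<^sup>2)
      = (\<Sum>a\<in>?I. \<Sum>b\<in>?I. expectation (\<lambda>\<omega>. \<Prod>i\<in>?I. h a b i (X i \<omega>)))"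
    unfolding expand
    by (simp add: Bochner_Integration.integral_sum int_ab Bochner_Integration.integrable_sum)
  also have "\<dots> = real n * expectation (\<lambda>\<omega>. w (X 1 \<omega>) * (g (X 1 \<omega>))\<^sup>2)"
    by (subst sum.cong[OF refl sum.cong[OF refl E_ab]]) simp_all
  finally show "expectation (\<lambda>\<omega>. (\<Prod>i=1..n. w (X i \<omega>)) * (\<Sum>i=1..n. g (X i \<omega>))\<^sup>2)
        = real n * expectation (\<lambda>\<omega>. w (X 1 \<omega>) * (g (X 1 \<omega>))\<^sup>2)" .
qed

end

section \<open>The law of large numbers for square-integrable functions\<close>

text \<open>The second moments of the averages are summable along the squares but not along all integers, and
  this closes the gaps. Between \<open>n\<^sup>2\<close> and \<open>(n + 1)\<^sup>2\<close> the sum can fall by at most the sum of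
  the absolute values over that block, which is \<open>o(n\<^sup>2)\<close> because the
  averages of the absolute values converge as well.\<close>

lemma eventually_sum_pos_if_averages_along_squares:
  fixes x :: "nat \<Rightarrow> real"
  assumes m: "(\<lambda>n. (\<Sum>i=1..n\<^sup>2. x i) / real (n\<^sup>2)) \<longlonglongrightarrow> m" and "m > 0"
    and v: "(\<lambda>n. (\<Sum>i=1..n\<^sup>2. \<bar>x i\<bar>) / real (n\<^sup>2)) \<longlonglongrightarrow> v"
  shows "\<forall>\<^sub>F n in sequentially. (\<Sum>i=1..n. x i) > 0"
proof -
  define S T where "S n = (\<Sum>i=1..n. x i)" and "T n = (\<Sum>i=1..n. \<bar>x i\<bar>)" for n
  have ratio: "(\<lambda>n. real ((Suc n)\<^sup>2) / real (n\<^sup>2)) \<longlonglongrightarrow> 1"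
    by real_asymp
  have "(\<lambda>n. T ((Suc n)\<^sup>2) / real ((Suc n)\<^sup>2)) \<longlonglongrightarrow> v"
    using LIMSEQ_Suc[OF v] by (simp add: T_def)
  from tendsto_mult[OF this ratio] have T: "(\<lambda>n. T ((Suc n)\<^sup>2) / real (n\<^sup>2)) \<longlonglongrightarrow> v"
    by (simp del: of_nat_power of_nat_Suc)
  have "(\<lambda>n. S (n\<^sup>2) / real (n\<^sup>2) - (T ((Suc n)\<^sup>2) / real (n\<^sup>2) - T (n\<^sup>2) / real (n\<^sup>2))) \<longlonglongrightarrow> m - (v - v)"
    by (intro tendsto_diff T) (use m v in \<open>simp_all add: S_def T_def\<close>)
  then have "\<forall>\<^sub>F n in sequentially.
      S (n\<^sup>2) / real (n\<^sup>2) - (T ((Suc n)\<^sup>2) / real (n\<^sup>2) - T (n\<^sup>2) / real (n\<^sup>2)) > 0"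
    using \<open>m > 0\<close> by (intro order_tendstoD(1)) auto
  then obtain n0 where n0: "S (n\<^sup>2) / real (n\<^sup>2) - (T ((Suc n)\<^sup>2) / real (n\<^sup>2) - T (n\<^sup>2) / real (n\<^sup>2)) > 0"
    if "n \<ge> n0" for n
    by (auto simp: eventually_sequentially)
  have "S k > 0" if k: "k \<ge> n0\<^sup>2" for k
  proof -
    let ?n = "floor_sqrt k"
    have n: "?n \<ge> n0" using k by (simp add: le_floor_sqrt_iff)
    have le: "?n\<^sup>2 \<le> k" and less: "k < (Suc ?n)\<^sup>2"
      by (simp, rule Suc_floor_sqrt_power2_gt)
    have split: "sum f {1..b} = sum f {1..a} + sum f {a<..b}" if "a \<le> b"
      for a b and f :: "nat \<Rightarrow> real"
      using that by (subst sum.union_disjoint[symmetric]) (auto intro!: sum.cong)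
    have "S (?n\<^sup>2) - (T ((Suc ?n)\<^sup>2) - T (?n\<^sup>2)) > 0"
    proof (cases "?n = 0")
      case True
      then show ?thesis using n0[OF n] by (simp add: S_def)
    next
      case False
      then have "real (?n\<^sup>2) > 0"
        by (simp only: of_nat_0_less_iff zero_less_power neq0_conv)
      moreover have "(S (?n\<^sup>2) - (T ((Suc ?n)\<^sup>2) - T (?n\<^sup>2))) / real (?n\<^sup>2) > 0"
        using n0[OF n] by (simp only: diff_divide_distrib)
      ultimately show ?thesis by (simp only: zero_less_divide_iff) linarith
    qed
    moreover have "T ((Suc ?n)\<^sup>2) - T (?n\<^sup>2) = (\<Sum>i\<in>{?n\<^sup>2<..(Suc ?n)\<^sup>2}. \<bar>x i\<bar>)"
      unfolding T_def by (subst split[of "?n\<^sup>2" "(Suc ?n)\<^sup>2"]) auto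
    moreover have "\<dots> \<ge> (\<Sum>i\<in>{?n\<^sup>2<..k}. \<bar>x i\<bar>)"
      using less by (intro sum_mono2) auto
    moreover have "S k = S (?n\<^sup>2) + (\<Sum>i\<in>{?n\<^sup>2<..k}. x i)"
      unfolding S_def by (rule split[OF le])
    moreover have "\<bar>\<Sum>i\<in>{?n\<^sup>2<..k}. x i\<bar> \<le> (\<Sum>i\<in>{?n\<^sup>2<..k}. \<bar>x i\<bar>)"
      by (rule sum_abs)
    ultimately show ?thesis by linarith
  qed
  then show ?thesis
    unfolding S_def eventually_sequentially by blast
qed

context iid_sequence
begin

text \<open>The second moment of the average of \<open>n\<^sup>2\<close> terms is a constant times \<open>1 / n\<^sup>2\<close>. The sum over all
  \<open>n\<close> of the squared averages therefore has finite expectation; it converges almost surely, so that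
  its terms tend to 0.\<close>

lemma mean_zero_average_squares_tendsto:
  fixes g :: "'a \<Rightarrow> real"
  assumes [measurable]: "g \<in> borel_measurable N"
    and int: "integrable P (\<lambda>\<omega>. g (X 1 \<omega>))" "integrable P (\<lambda>\<omega>. (g (X 1 \<omega>))\<^sup>2)"
    and mean: "expectation (\<lambda>\<omega>. g (X 1 \<omega>)) = 0"
  shows "AE \<omega> in P. (\<lambda>n. (\<Sum>i=1..n\<^sup>2. g (X i \<omega>)) / real (n\<^sup>2)) \<longlonglongrightarrow> 0"
proof -
  define Q where "Q n \<omega> = ((\<Sum>i=1..n\<^sup>2. g (X i \<omega>)) / real (n\<^sup>2))\<^sup>2" for n \<omega>
  define s where "s = expectation (\<lambda>\<omega>. (g (X 1 \<omega>))\<^sup>2)"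
  have [measurable]: "(\<lambda>\<omega>. g (X i \<omega>)) \<in> borel_measurable P" if "i \<ge> 1" for i
    using that by measurable
  have [measurable]: "Q n \<in> borel_measurable P" for n
    unfolding Q_def by measurable
  have Q_eq: "Q n = (\<lambda>\<omega>. ((\<Prod>i=1..n\<^sup>2. 1) * (\<Sum>i=1..n\<^sup>2. g (X i \<omega>))\<^sup>2) / (real (n\<^sup>2))\<^sup>2)" for n
    by (simp add: Q_def power_divide fun_eq_iff)
  have Q_int: "integrable P (Q n)" for n
    unfolding Q_eq
    by (intro Bochner_Integration.integrable_divide integrable_weighted_square)
       (use int mean in \<open>simp_all add: prob_space\<close>)
  have "expectation (Q n) = real (n\<^sup>2) * s / (real (n\<^sup>2))\<^sup>2" for n
    unfolding Q_eq integral_divide_zero s_def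
    by (subst weighted_second_moment) (use int mean in \<open>simp_all add: prob_space\<close>)
  then have Q_E: "expectation (Q n) = s / (real n)\<^sup>2" for n
    by (simp add: power2_eq_square)
  have summ: "summable (\<lambda>n. s / (real n)\<^sup>2)"
    using summable_mult[OF inverse_power_summable[of 2, where 'a=real], of s]
    by (simp add: field_simps)
  have "(\<integral>\<^sup>+\<omega>. (\<Sum>n. ennreal (Q n \<omega>)) \<partial>P) = (\<Sum>n. \<integral>\<^sup>+\<omega>. ennreal (Q n \<omega>) \<partial>P)"
    by (rule nn_integral_suminf) measurable
  also have "\<dots> = (\<Sum>n. ennreal (s / (real n)\<^sup>2))"
    by (subst nn_integral_eq_integral[OF Q_int]) (auto simp: Q_def Q_E[symmetric])
  also have "\<dots> \<noteq> \<infinity>"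
    using summ by (subst suminf_ennreal2) (auto simp: s_def)
  finally have "AE \<omega> in P. (\<Sum>n. ennreal (Q n \<omega>)) \<noteq> \<infinity>"
    by (intro nn_integral_PInf_AE) auto
  then show ?thesis
  proof eventually_elim
    case (elim \<omega>)
    then have "summable (\<lambda>n. Q n \<omega>)"
      by (intro summable_suminf_not_top) (auto simp: Q_def)
    then have "(\<lambda>n. Q n \<omega>) \<longlonglongrightarrow> 0" by (rule summable_LIMSEQ_zero)
    then have "(\<lambda>n. sqrt (Q n \<omega>)) \<longlonglongrightarrow> 0"
      using tendsto_real_sqrt[of "\<lambda>n. Q n \<omega>" 0] by simp
    then show ?case
      unfolding Q_def real_sqrt_abs by (rule tendsto_rabs_zero_cancel)
  qed
qed

lemma square_integrable_imp_integrable_1: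
  fixes g :: "'a \<Rightarrow> real"
  assumes [measurable]: "g \<in> borel_measurable N" and "integrable P (\<lambda>\<omega>. (g (X 1 \<omega>))\<^sup>2)"
  shows "integrable P (\<lambda>\<omega>. g (X 1 \<omega>))"
  by (rule square_integrable_imp_integrable) (use assms in auto)

lemma average_squares_tendsto:
  fixes g :: "'a \<Rightarrow> real"
  assumes g: "g \<in> borel_measurable N"
    and int2: "integrable P (\<lambda>\<omega>. (g (X 1 \<omega>))\<^sup>2)"
  shows "AE \<omega> in P. (\<lambda>n. (\<Sum>i=1..n\<^sup>2. g (X i \<omega>)) / real (n\<^sup>2))
           \<longlonglongrightarrow> expectation (\<lambda>\<omega>. g (X 1 \<omega>))"
proof -
  note [measurable] = g
  note int = square_integrable_imp_integrable_1[OF g int2]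
  define m where "m = expectation (\<lambda>\<omega>. g (X 1 \<omega>))"
  have "AE \<omega> in P. (\<lambda>n. (\<Sum>i=1..n\<^sup>2. g (X i \<omega>) - m) / real (n\<^sup>2)) \<longlonglongrightarrow> 0"
  proof (rule mean_zero_average_squares_tendsto)
    show "integrable P (\<lambda>\<omega>. (g (X 1 \<omega>) - m)\<^sup>2)"
      using int int2 by (simp add: power2_diff)
  qed (use int in \<open>auto simp: m_def prob_space\<close>)
  then show ?thesis
  proof eventually_elim
    case (elim \<omega>)
    have "(\<lambda>n. (\<Sum>i=1..n\<^sup>2. g (X i \<omega>) - m) / real (n\<^sup>2) + m) \<longlonglongrightarrow> 0 + m"
      by (intro tendsto_add elim tendsto_const)
    moreover have "\<forall>\<^sub>F n in sequentially. (\<Sum>i=1..n\<^sup>2. g (X i \<omega>) - m) / real (n\<^sup>2) + m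
        = (\<Sum>i=1..n\<^sup>2. g (X i \<omega>)) / real (n\<^sup>2)"
      using eventually_gt_at_top[of 0]
      by eventually_elim (simp add: sum_subtractf field_simps)
    ultimately show ?case
      unfolding m_def[symmetric] by (simp add: tendsto_cong)
  qed
qed

lemma AE_eventually_sum_pos:
  fixes g :: "'a \<Rightarrow> real"
  assumes g: "g \<in> borel_measurable N"
    and int2: "integrable P (\<lambda>\<omega>. (g (X 1 \<omega>))\<^sup>2)"
    and pos: "expectation (\<lambda>\<omega>. g (X 1 \<omega>)) > 0"
  shows "AE \<omega> in P. \<forall>\<^sub>F n in sequentially. (\<Sum>i=1..n. g (X i \<omega>)) > 0"
proof -
  have 1: "AE \<omega> in P. (\<lambda>n. (\<Sum>i=1..n\<^sup>2. g (X i \<omega>)) / real (n\<^sup>2))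
             \<longlonglongrightarrow> expectation (\<lambda>\<omega>. g (X 1 \<omega>))"
    by (rule average_squares_tendsto[OF g int2])
  have 2: "AE \<omega> in P. (\<lambda>n. (\<Sum>i=1..n\<^sup>2. \<bar>g (X i \<omega>)\<bar>) / real (n\<^sup>2))
             \<longlonglongrightarrow> expectation (\<lambda>\<omega>. \<bar>g (X 1 \<omega>)\<bar>)"
    by (rule average_squares_tendsto[of "\<lambda>x. \<bar>g x\<bar>"]) (use int2 in \<open>simp_all add: borel_measurable_abs g\<close>)
  from 1 2 show ?thesis
    by eventually_elim (rule eventually_sum_pos_if_averages_along_squares[OF _ pos])
qed

end

section \<open>Visits of a centred random walk to the positive orthant\<close>

text \<open>Being infinitely often above every level is insensitive to a bounded shift, hence to a change of
  finitely many increments. This is what makes the event of the 0-1 law below a tail event; visits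
  to the orthant itself would not form one.\<close>

lemma frequently_ge_shift:
  fixes a b :: "'i \<Rightarrow> nat \<Rightarrow> real"
  assumes "finite I" and shift: "\<And>i. i \<in> I \<Longrightarrow> \<forall>\<^sub>F n in sequentially. a i n = b i n + D i"
    and freq: "\<forall>K::nat. \<exists>\<^sub>F n in sequentially. \<forall>i\<in>I. real K \<le> b i n"
  shows "\<forall>K::nat. \<exists>\<^sub>F n in sequentially. \<forall>i\<in>I. real K \<le> a i n"
proof
  fix K :: nat
  define K' where "K' = nat \<lceil>real K + (\<Sum>i\<in>I. \<bar>D i\<bar>)\<rceil>"
  have K': "real K' \<ge> real K + \<bar>D i\<bar>" if "i \<in> I" for i
  proof -
    have "\<bar>D i\<bar> \<le> (\<Sum>i\<in>I. \<bar>D i\<bar>)"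
      using \<open>finite I\<close> that by (intro member_le_sum) auto
    then show ?thesis unfolding K'_def by linarith
  qed
  have "\<forall>\<^sub>F n in sequentially. \<forall>i\<in>I. a i n = b i n + D i"
    using \<open>finite I\<close> shift by (simp add: eventually_ball_finite)
  with freq[rule_format, of K']
  have "\<exists>\<^sub>F n in sequentially. (\<forall>i\<in>I. real K' \<le> b i n) \<and> (\<forall>i\<in>I. a i n = b i n + D i)"
    by (rule frequently_eventually_frequently)
  then show "\<exists>\<^sub>F n in sequentially. \<forall>i\<in>I. real K \<le> a i n"
  proof (rule frequently_elim1, intro ballI)
    fix n i
    assume "(\<forall>i\<in>I. real K' \<le> b i n) \<and> (\<forall>i\<in>I. a i n = b i n + D i)" and "i \<in> I"
    then show "real K \<le> a i n" using K'[of i] by (smt (verit))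
  qed
qed

context iid_sequence
begin

text \<open>The density \<open>L = \<Prod>l\<le>n. (1 + r * \<theta> (X l))\<close> with \<open>r = \<epsilon> / sqrt n\<close> gives every sum the mean
  \<open>\<epsilon> * sqrt n\<close> and a variance of order \<open>n\<close>, so for large \<open>\<epsilon>\<close> the event \<open>A\<close> that all sums exceed
  \<open>sqrt n\<close> has probability at least \<open>1/2\<close> under \<open>L\<close>. Its original probability is bounded below
  because the second moment of \<open>L\<close> is at most \<open>(1 + \<epsilon>\<^sup>2 * B\<^sup>2 / n) ^ n \<le> exp (\<epsilon>\<^sup>2 * B\<^sup>2) = M\<close>.\<close>

lemma tilting_lower_bound:
  fixes g :: "'i \<Rightarrow> 'a \<Rightarrow> real" and \<theta> :: "'a \<Rightarrow> real"
  assumes I: "finite I"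
    and g [measurable]: "\<And>i. g i \<in> borel_measurable N"
    and g2: "\<And>i. i \<in> I \<Longrightarrow> integrable P (\<lambda>\<omega>. (g i (X 1 \<omega>))\<^sup>2)"
    and g_mean: "\<And>i. i \<in> I \<Longrightarrow> expectation (\<lambda>\<omega>. g i (X 1 \<omega>)) = 0"
    and \<theta> [measurable]: "\<theta> \<in> borel_measurable N"
    and \<theta>_bound: "\<And>x. \<bar>\<theta> x\<bar> \<le> B"
    and \<theta>_mean: "expectation (\<lambda>\<omega>. \<theta> (X 1 \<omega>)) = 0"
    and \<theta>_g: "\<And>i. i \<in> I \<Longrightarrow> expectation (\<lambda>\<omega>. \<theta> (X 1 \<omega>) * g i (X 1 \<omega>)) = 1"
  shows "\<exists>\<delta>>0. \<forall>\<^sub>F n in sequentially.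
           \<delta> \<le> prob {\<omega> \<in> space P. \<forall>i\<in>I. sqrt (real n) \<le> (\<Sum>l=1..n. g i (X l \<omega>))}"
proof -
  define \<sigma> where "\<sigma> = (\<Sum>i\<in>I. expectation (\<lambda>\<omega>. (g i (X 1 \<omega>))\<^sup>2))"
  \<comment> \<open>Under \<open>L\<close> the failure of a sum to reach \<open>sqrt n\<close> is a
    deviation by more than \<open>c * sqrt n\<close>. The probability that some sum fails is at most
    \<open>2 * \<sigma> / c\<^sup>2\<close>, and \<open>c\<close> is chosen to make this at most
    \<open>1/2\<close>.\<close>
  define c \<epsilon> M where "c = 1 + 4 * \<sigma>" and "\<epsilon> = 1 + c" and "M = exp (\<epsilon>\<^sup>2 * B\<^sup>2)"
  have \<sigma>: "\<sigma> \<ge> 0" unfolding \<sigma>_def by (intro sum_nonneg) auto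
  have c: "c \<ge> 1" and \<epsilon>: "\<epsilon> > 0" and M: "M > 0"
    using \<sigma> by (auto simp: c_def \<epsilon>_def M_def)
  have B: "B \<ge> 0" using \<theta>_bound[of undefined] by linarith
  have int_\<theta>: "integrable P (\<lambda>\<omega>. \<theta> (X 1 \<omega>))"
    by (rule integrable_const_bound[of _ B]) (use \<theta>_bound in auto)
  have int_\<theta>2: "integrable P (\<lambda>\<omega>. (\<theta> (X 1 \<omega>))\<^sup>2)"
    by (rule integrable_const_bound[of _ "B\<^sup>2"])
       (use \<theta>_bound B in \<open>auto simp: abs_le_square_iff[symmetric]\<close>)
  have \<theta>2: "expectation (\<lambda>\<omega>. (\<theta> (X 1 \<omega>))\<^sup>2) \<le> B\<^sup>2"
    using integral_mono[OF int_\<theta>2, of "\<lambda>_. B\<^sup>2"] \<theta>_bound B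
    by (auto simp: abs_le_square_iff[symmetric] prob_space)
  have int_\<theta>_mult: "integrable P (\<lambda>\<omega>. \<theta> (X 1 \<omega>) * f (X 1 \<omega>))"
    if "integrable P (\<lambda>\<omega>. f (X 1 \<omega>))" and [measurable]: "f \<in> borel_measurable N" for f :: "'a \<Rightarrow> real"
    by (rule Bochner_Integration.integrable_bound[of P "\<lambda>\<omega>. B * f (X 1 \<omega>)"])
       (use that \<theta>_bound B in \<open>auto simp: abs_mult intro!: mult_right_mono\<close>)
  have int_g: "integrable P (\<lambda>\<omega>. g i (X 1 \<omega>))" if "i \<in> I" for i
    by (rule square_integrable_imp_integrable_1) (use that g2 in auto)
  have "1 / (4 * M) \<le> prob {\<omega> \<in> space P. \<forall>i\<in>I. sqrt (real n) \<le> (\<Sum>l=1..n. g i (X l \<omega>))}"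
    if n: "n \<ge> 1" and large: "\<epsilon> * B \<le> sqrt (real n)" for n
  proof -
    define A where "A = {\<omega> \<in> space P. \<forall>i\<in>I. sqrt (real n) \<le> (\<Sum>l=1..n. g i (X l \<omega>))}"
    define r where "r = \<epsilon> / sqrt (real n)"
    define w where "w x = 1 + r * \<theta> x" for x
    define L where "L \<omega> = (\<Prod>l=1..n. w (X l \<omega>))" for \<omega>
    \<comment> \<open>centred under the new measure\<close>
    define h where "h i x = g i x - r" for i x
    have [measurable]: "w \<in> borel_measurable N" "\<And>i. h i \<in> borel_measurable N"
      unfolding w_def h_def by measurable
    have [measurable]: "(\<lambda>\<omega>. g i (X l \<omega>)) \<in> borel_measurable P" if "l \<ge> 1" for i l
      using that by measurable
    have A [measurable]: "A \<in> events"
      unfolding A_def using I by measurable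
    have r: "r > 0" and rn: "r * sqrt (real n) = \<epsilon>" and r2: "r\<^sup>2 = \<epsilon>\<^sup>2 / real n"
      using n \<epsilon> by (auto simp: r_def power_divide)
    have rB: "r * B \<le> 1" using large n by (simp add: r_def field_simps)
    have r\<theta>: "\<bar>r * \<theta> x\<bar> \<le> 1" for x
    proof -
      have "r * \<bar>\<theta> x\<bar> \<le> r * B"
        using \<theta>_bound[of x] r by (intro mult_left_mono) auto
      also note rB
      finally show ?thesis using r by (simp add: abs_mult)
    qed
    have w: "0 \<le> w x" "w x \<le> 2" for x
      using r\<theta>[of x] by (auto simp: w_def)
    have L0: "L \<omega> \<ge> 0" for \<omega> unfolding L_def by (intro prod_nonneg) (simp add: w)
    have int_w: "integrable P (\<lambda>\<omega>. w (X 1 \<omega>))" and E_w: "expectation (\<lambda>\<omega>. w (X 1 \<omega>)) = 1"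
      using int_\<theta> \<theta>_mean by (simp_all add: w_def prob_space)
    have w_sq: "(w x)\<^sup>2 = 1 + 2 * r * \<theta> x + r\<^sup>2 * (\<theta> x)\<^sup>2" for x
      by (simp add: w_def power2_eq_square algebra_simps)
    have int_w2: "integrable P (\<lambda>\<omega>. (w (X 1 \<omega>))\<^sup>2)"
      using int_\<theta> int_\<theta>2 by (simp add: w_sq)
    have E_w2: "expectation (\<lambda>\<omega>. (w (X 1 \<omega>))\<^sup>2) = 1 + r\<^sup>2 * expectation (\<lambda>\<omega>. (\<theta> (X 1 \<omega>))\<^sup>2)"
      using int_\<theta> int_\<theta>2 \<theta>_mean by (simp add: w_sq prob_space)
    have int_L: "integrable P L" and E_L: "expectation L = 1"
      unfolding L_def using expectation_prod[of "{1..n}" "\<lambda>_. w"] integrable_prod[of "{1..n}" "\<lambda>_. w"]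
        int_w E_w by auto
    have L_sq: "(L \<omega>)\<^sup>2 = (\<Prod>l=1..n. (w (X l \<omega>))\<^sup>2)" for \<omega>
      by (simp add: L_def prod_power_distrib)
    have int_L2: "integrable P (\<lambda>\<omega>. (L \<omega>)\<^sup>2)"
      unfolding L_sq by (rule integrable_prod) (use int_w2 in auto)
    have "expectation (\<lambda>\<omega>. (L \<omega>)\<^sup>2) = (1 + r\<^sup>2 * expectation (\<lambda>\<omega>. (\<theta> (X 1 \<omega>))\<^sup>2)) ^ n"
      unfolding L_sq by (subst expectation_prod) (use int_w2 E_w2 in auto)
    also have "\<dots> \<le> (1 + r\<^sup>2 * B\<^sup>2) ^ n"
      using \<theta>2 by (intro power_mono add_left_mono mult_left_mono) auto
    also have "\<dots> = (1 + (\<epsilon>\<^sup>2 * B\<^sup>2) / real n) ^ n"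
      by (simp add: r2)
    also have "\<dots> \<le> M"
      unfolding M_def using n by (intro exp_ge_one_plus_x_over_n_power_n) (auto intro: order_trans[of _ 0])
    finally have E_L2: "expectation (\<lambda>\<omega>. (L \<omega>)\<^sup>2) \<le> M" .

    have h_facts: "integrable P (\<lambda>\<omega>. w (X 1 \<omega>) * h i (X 1 \<omega>))"
        "integrable P (\<lambda>\<omega>. w (X 1 \<omega>) * (h i (X 1 \<omega>))\<^sup>2)"
        "expectation (\<lambda>\<omega>. w (X 1 \<omega>) * h i (X 1 \<omega>)) = 0"
        "expectation (\<lambda>\<omega>. w (X 1 \<omega>) * (h i (X 1 \<omega>))\<^sup>2) \<le> 2 * expectation (\<lambda>\<omega>. (g i (X 1 \<omega>))\<^sup>2)"
      if i: "i \<in> I" for i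
    proof -
      have int_wg: "integrable P (\<lambda>\<omega>. w (X 1 \<omega>) * g i (X 1 \<omega>))"
        using int_g[OF i] int_\<theta>_mult[OF int_g[OF i]] by (simp add: w_def algebra_simps)
      have E_wg: "expectation (\<lambda>\<omega>. w (X 1 \<omega>) * g i (X 1 \<omega>)) = r"
        using int_g[OF i] int_\<theta>_mult[OF int_g[OF i]] g_mean[OF i] \<theta>_g[OF i]
        by (simp add: w_def algebra_simps)
      have int_wg2: "integrable P (\<lambda>\<omega>. w (X 1 \<omega>) * (g i (X 1 \<omega>))\<^sup>2)"
        using g2[OF i] int_\<theta>_mult[of "\<lambda>x. (g i x)\<^sup>2"] by (simp add: w_def algebra_simps)
      have E_wg2: "expectation (\<lambda>\<omega>. w (X 1 \<omega>) * (g i (X 1 \<omega>))\<^sup>2) \<le> expectation (\<lambda>\<omega>. 2 * (g i (X 1 \<omega>))\<^sup>2)"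
        by (rule integral_mono) (use int_wg2 g2[OF i] w in \<open>auto intro: mult_right_mono\<close>)
      have eq1: "w x * h i x = w x * g i x - r * w x" for x
        by (simp add: h_def algebra_simps)
      have eq2: "w x * (h i x)\<^sup>2 = w x * (g i x)\<^sup>2 - 2 * r * (w x * g i x) + r\<^sup>2 * w x" for x
        by (simp add: h_def power2_eq_square algebra_simps)
      show "integrable P (\<lambda>\<omega>. w (X 1 \<omega>) * h i (X 1 \<omega>))"
        "expectation (\<lambda>\<omega>. w (X 1 \<omega>) * h i (X 1 \<omega>)) = 0"
        unfolding eq1 using int_wg int_w E_w E_wg by auto
      show "integrable P (\<lambda>\<omega>. w (X 1 \<omega>) * (h i (X 1 \<omega>))\<^sup>2)"
        unfolding eq2 using int_wg int_w int_wg2 by auto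
      have "expectation (\<lambda>\<omega>. w (X 1 \<omega>) * (h i (X 1 \<omega>))\<^sup>2)
          = expectation (\<lambda>\<omega>. w (X 1 \<omega>) * (g i (X 1 \<omega>))\<^sup>2) - 2 * r * r + r\<^sup>2"
        unfolding eq2 using int_wg int_w int_wg2 E_w E_wg by simp
      also have "\<dots> \<le> 2 * expectation (\<lambda>\<omega>. (g i (X 1 \<omega>))\<^sup>2)"
        using E_wg2 by (simp add: power2_eq_square) (smt (verit) zero_le_square)
      finally show "expectation (\<lambda>\<omega>. w (X 1 \<omega>) * (h i (X 1 \<omega>))\<^sup>2)
          \<le> 2 * expectation (\<lambda>\<omega>. (g i (X 1 \<omega>))\<^sup>2)" .
    qed
    define H where "H i \<omega> = L \<omega> * (\<Sum>l=1..n. h i (X l \<omega>))\<^sup>2" for i \<omega>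
    have int_H: "integrable P (H i)" if "i \<in> I" for i
      unfolding H_def[abs_def] L_def
      by (rule integrable_weighted_square) (use int_w E_w h_facts[OF that] in auto)
    have E_H: "expectation (H i) \<le> real n * (2 * expectation (\<lambda>\<omega>. (g i (X 1 \<omega>))\<^sup>2))"
      if "i \<in> I" for i
    proof -
      have "expectation (H i) = real n * expectation (\<lambda>\<omega>. w (X 1 \<omega>) * (h i (X 1 \<omega>))\<^sup>2)"
        unfolding H_def[abs_def] L_def
        by (rule weighted_second_moment) (use int_w E_w h_facts[OF that] in auto)
      then show ?thesis using h_facts(4)[OF that] by (simp add: mult_left_mono)
    qed
    have H0: "H i \<omega> \<ge> 0" for i \<omega> by (simp add: H_def L0)
    \<comment> \<open>On \<open>A\<close> this is the inequality of arithmetic and geometric means, in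
      place of the Cauchy-Schwarz inequality; off \<open>A\<close> it is the one behind Chebyshev's
      inequality.\<close>
    have pointwise: "L \<omega> \<le> (L \<omega>)\<^sup>2 / (4 * M) + M * indicator A \<omega> + (\<Sum>i\<in>I. H i \<omega>) / (c\<^sup>2 * real n)"
      if \<omega>: "\<omega> \<in> space P" for \<omega>
    proof (cases "\<omega> \<in> A")
      case True
      have "0 \<le> (L \<omega> - 2 * M)\<^sup>2 / (4 * M)" using M by auto
      also have "\<dots> = (L \<omega>)\<^sup>2 / (4 * M) - L \<omega> + M"
        using M by (simp add: power2_eq_square field_simps)
      finally have "L \<omega> \<le> (L \<omega>)\<^sup>2 / (4 * M) + M" by simp
      moreover have "0 \<le> (\<Sum>i\<in>I. H i \<omega>) / (c\<^sup>2 * real n)"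
        by (intro divide_nonneg_nonneg sum_nonneg H0) auto
      ultimately show ?thesis using True by simp
    next
      case False
      then obtain i where i: "i \<in> I" "(\<Sum>l=1..n. g i (X l \<omega>)) < sqrt (real n)"
        using \<omega> by (auto simp: A_def not_le)
      have "r * real n = \<epsilon> * sqrt (real n)"
        using rn by (metis mult.assoc real_sqrt_mult_self abs_of_nat)
      then have "(\<Sum>l=1..n. h i (X l \<omega>)) = (\<Sum>l=1..n. g i (X l \<omega>)) - \<epsilon> * sqrt (real n)"
        by (simp add: h_def sum_subtractf mult.commute)
      with i(2) have "c * sqrt (real n) \<le> - (\<Sum>l=1..n. h i (X l \<omega>))"
        by (simp add: \<epsilon>_def algebra_simps)
      then have "(c * sqrt (real n))\<^sup>2 \<le> (- (\<Sum>l=1..n. h i (X l \<omega>)))\<^sup>2"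
        using c by (intro power_mono) auto
      then have "c\<^sup>2 * real n \<le> (\<Sum>l=1..n. h i (X l \<omega>))\<^sup>2"
        by (simp add: power_mult_distrib)
      then have "L \<omega> * (c\<^sup>2 * real n) \<le> H i \<omega>"
        unfolding H_def by (intro mult_left_mono L0)
      also have "\<dots> \<le> (\<Sum>i\<in>I. H i \<omega>)"
        using I i by (intro member_le_sum H0) auto
      finally have "L \<omega> \<le> (\<Sum>i\<in>I. H i \<omega>) / (c\<^sup>2 * real n)"
        using c n by (subst pos_le_divide_eq) auto
      moreover have "0 \<le> (L \<omega>)\<^sup>2 / (4 * M)" using M by simp
      ultimately show ?thesis using False by simp
    qed
    have int_A: "integrable P (indicator A :: 'w \<Rightarrow> real)"
      by (intro integrable_real_indicator A) (simp add: emeasure_eq_measure)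
    have int_rhs: "integrable P (\<lambda>\<omega>. (L \<omega>)\<^sup>2 / (4 * M) + M * indicator A \<omega> + (\<Sum>i\<in>I. H i \<omega>) / (c\<^sup>2 * real n))"
      by (intro Bochner_Integration.integrable_add integrable_divide_zero integrable_mult_right
          Bochner_Integration.integrable_sum int_L2 int_A int_H) auto
    have "expectation L \<le> expectation (\<lambda>\<omega>. (L \<omega>)\<^sup>2 / (4 * M) + M * indicator A \<omega> + (\<Sum>i\<in>I. H i \<omega>) / (c\<^sup>2 * real n))"
      by (rule integral_mono[OF int_L int_rhs pointwise])
    also have "\<dots> = expectation (\<lambda>\<omega>. (L \<omega>)\<^sup>2) / (4 * M) + M * prob A
        + (\<Sum>i\<in>I. expectation (H i)) / (c\<^sup>2 * real n)"
      using int_L2 int_A int_H by (simp add: Bochner_Integration.integral_sum Bochner_Integration.integrable_sum)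
    also have "\<dots> \<le> M / (4 * M) + M * prob A
        + (\<Sum>i\<in>I. real n * (2 * expectation (\<lambda>\<omega>. (g i (X 1 \<omega>))\<^sup>2))) / (c\<^sup>2 * real n)"
      using E_L2 E_H M by (intro add_mono divide_right_mono sum_mono) auto
    also have "\<dots> = 1 / 4 + M * prob A + 2 * \<sigma> / c\<^sup>2"
      using M n by (simp add: \<sigma>_def sum_distrib_left[symmetric])
    finally have "1 \<le> 1 / 4 + M * prob A + 2 * \<sigma> / c\<^sup>2"
      by (simp add: E_L)
    moreover have "2 * \<sigma> / c\<^sup>2 \<le> 1 / 2"
    proof -
      have "4 * \<sigma> \<le> c" by (simp add: c_def)
      also have "\<dots> \<le> c\<^sup>2" using c by (simp add: power2_eq_square)
      finally show ?thesis using c by (simp add: field_simps)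
    qed
    ultimately have "1 / 4 \<le> M * prob A" by linarith
    then have "1 \<le> prob A * (4 * M)" by (simp add: mult_ac)
    then have "1 / (4 * M) \<le> prob A"
      using M by (subst pos_divide_le_eq) auto
    then show ?thesis
      unfolding A_def .
  qed
  note bound = this
  have "\<forall>\<^sub>F n in sequentially. n \<ge> 1 \<and> \<epsilon> * B \<le> sqrt (real n)"
  proof -
    have "filterlim (\<lambda>n. sqrt (real n)) at_top sequentially" by real_asymp
    then show ?thesis
      by (intro eventually_conj eventually_ge_at_top) (simp add: filterlim_at_top)
  qed
  then have "\<forall>\<^sub>F n in sequentially.
      1 / (4 * M) \<le> prob {\<omega> \<in> space P. \<forall>i\<in>I. sqrt (real n) \<le> (\<Sum>l=1..n. g i (X l \<omega>))}"
    by (rule eventually_mono) (use bound in blast)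
  then show ?thesis using M by (intro exI[of _ "1 / (4 * M)"]) auto
qed

text \<open>By \<open>frequently_ge_shift\<close> the event \<open>T\<close> does not change if the first \<open>m\<close> increments are omitted,
  so it is determined by the variables after time \<open>m\<close>, for every \<open>m\<close>.\<close>

lemma infinitely_often_above_all_levels_0_1:
  fixes g :: "'i \<Rightarrow> 'a \<Rightarrow> real"
  assumes I: "finite I" and g [measurable]: "\<And>i. g i \<in> borel_measurable N"
  defines "T \<equiv> {\<omega> \<in> space P. \<forall>K::nat. \<exists>\<^sub>F n in sequentially. \<forall>i\<in>I. real K \<le> (\<Sum>l=1..n. g i (X l \<omega>))}"
  shows "prob T = 0 \<or> prob T = 1"
proof -
  define A where "A j = sigma_sets (space P) {X (Suc j) -` B \<inter> space P | B. B \<in> sets N}" for j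
  have A_algebra: "sigma_algebra (space P) (A j)" for j
    unfolding A_def by (intro sigma_algebra_sigma_sets) auto
  have ind: "indep_sets (\<lambda>i. sigma_sets (space P) {X i -` B \<inter> space P | B. B \<in> sets N}) {1..}"
    using indep by (simp add: indep_vars_def)
  have A_indep: "indep_sets A UNIV"
  proof (rule indep_setsI)
    show "A j \<subseteq> events" for j
      using ind by (auto simp: indep_sets_def A_def)
    fix B and J :: "nat set"
    assume J: "J \<noteq> {}" "finite J" and B: "\<forall>j\<in>J. B j \<in> A j"
    have "prob (\<Inter>i\<in>Suc ` J. B (i - 1)) = (\<Prod>i\<in>Suc ` J. prob (B (i - 1)))"
      by (rule indep_setsD[OF ind]) (use J B in \<open>auto simp: A_def\<close>)
    then show "prob (\<Inter>j\<in>J. B j) = (\<Prod>j\<in>J. prob (B j))"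
      by (simp add: prod.reindex)
  qed
  have "T \<in> tail_events A"
    unfolding tail_events_def
  proof
    fix m :: nat
    define S where "S = sigma (space P) (\<Union> (A ` {m..}))"
    have sub: "\<Union> (A ` {m..}) \<subseteq> Pow (space P)"
      unfolding A_def using sigma_sets_into_sp[of "{X (Suc j) -` B \<inter> space P | B. B \<in> sets N}" "space P" for j]
      by fastforce
    have space_S: "space S = space P" and sets_S: "sets S = sigma_sets (space P) (\<Union> (A ` {m..}))"
      using sub by (auto simp: S_def space_measure_of sets_measure_of)
    have X_S: "X l \<in> measurable S N" if "l > m" for l
    proof (rule measurableI)
      show "X l \<omega> \<in> space N" if "\<omega> \<in> space S" for \<omega>
        using measurable_space[OF X_measurable[of l]] that \<open>l > m\<close> by (simp add: space_S)
      fix B assume "B \<in> sets N"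
      then have "X l -` B \<inter> space P \<in> A (l - 1)"
        using that by (auto simp: A_def)
      then show "X l -` B \<inter> space S \<in> sets S"
        using that by (auto simp: sets_S space_S intro!: sigma_sets.Basic bexI[of _ "l - 1"])
    qed
    have [measurable]: "(\<lambda>\<omega>. \<Sum>l\<in>{m<..n}. g i (X l \<omega>)) \<in> borel_measurable S" for i n
      using X_S by (intro borel_measurable_sum measurable_compose[OF _ g]) auto
    have "T = {\<omega> \<in> space S. \<forall>K::nat. \<exists>\<^sub>F n in sequentially. \<forall>i\<in>I. real K \<le> (\<Sum>l\<in>{m<..n}. g i (X l \<omega>))}"
    proof -
      have split: "\<forall>\<^sub>F n in sequentially. (\<Sum>l=1..n. f l) = (\<Sum>l\<in>{m<..n}. f l) + (\<Sum>l=1..m. f l)"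
        for f :: "nat \<Rightarrow> real"
        using eventually_ge_at_top[of m]
      proof eventually_elim
        case (elim n)
        have "sum f {1..n} = sum f ({m<..n} \<union> {1..m})"
          using elim by (intro sum.cong) auto
        also have "\<dots> = sum f {m<..n} + sum f {1..m}"
          by (rule sum.union_disjoint) auto
        finally show ?case .
      qed
      have split': "\<forall>\<^sub>F n in sequentially. (\<Sum>l\<in>{m<..n}. f l) = (\<Sum>l=1..n. f l) + - (\<Sum>l=1..m. f l)"
        for f :: "nat \<Rightarrow> real"
        using split[of f] by eventually_elim simp
      show ?thesis
        unfolding T_def space_S
        by (intro Collect_cong conj_cong refl iffI; erule frequently_ge_shift[OF I, rotated])
           (rule split split')+
    qed
    also have "\<dots> \<in> sets S"
      unfolding frequently_sequentially using I by measurable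
    finally show "T \<in> sigma_sets (space P) (\<Union> (A ` {m..}))"
      by (simp add: sets_S)
  qed
  then show ?thesis
    by (rule kolmogorov_0_1_law[OF A_algebra A_indep])
qed

text \<open>The sums exceed \<open>sqrt n\<close> at time \<open>n\<close> with probability at least \<open>\<delta>\<close>, so with probability at least
  \<open>\<delta>\<close> this happens for infinitely many \<open>n\<close>. On that event they are infinitely often above every
  level, and the 0-1 law applies.\<close>

lemma AE_frequently_all_sums_nonneg:
  fixes g :: "'i \<Rightarrow> 'a \<Rightarrow> real" and \<theta> :: "'a \<Rightarrow> real"
  assumes I: "finite I"
    and g [measurable]: "\<And>i. g i \<in> borel_measurable N"
    and g2: "\<And>i. i \<in> I \<Longrightarrow> integrable P (\<lambda>\<omega>. (g i (X 1 \<omega>))\<^sup>2)"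
    and g_mean: "\<And>i. i \<in> I \<Longrightarrow> expectation (\<lambda>\<omega>. g i (X 1 \<omega>)) = 0"
    and \<theta>: "\<theta> \<in> borel_measurable N"
    and \<theta>_bound: "\<And>x. \<bar>\<theta> x\<bar> \<le> B"
    and \<theta>_mean: "expectation (\<lambda>\<omega>. \<theta> (X 1 \<omega>)) = 0"
    and \<theta>_g: "\<And>i. i \<in> I \<Longrightarrow> expectation (\<lambda>\<omega>. \<theta> (X 1 \<omega>) * g i (X 1 \<omega>)) = 1"
  shows "AE \<omega> in P. \<exists>\<^sub>F n in sequentially. \<forall>i\<in>I. 0 \<le> (\<Sum>l=1..n. g i (X l \<omega>))"
proof -
  define T where "T = {\<omega> \<in> space P. \<forall>K::nat. \<exists>\<^sub>F n in sequentially. \<forall>i\<in>I. real K \<le> (\<Sum>l=1..n. g i (X l \<omega>))}"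
  define A where "A n = {\<omega> \<in> space P. \<forall>i\<in>I. sqrt (real n) \<le> (\<Sum>l=1..n. g i (X l \<omega>))}" for n
  have [measurable]: "(\<lambda>\<omega>. g i (X l \<omega>)) \<in> borel_measurable P" if "l \<ge> 1" for i l
    using that by measurable
  have A [measurable]: "A n \<in> events" for n
    unfolding A_def using I by measurable
  have T: "T \<in> events"
    unfolding T_def frequently_sequentially using I by measurable
  obtain \<delta> where \<delta>: "\<delta> > 0" "\<forall>\<^sub>F n in sequentially. \<delta> \<le> prob (A n)"
  proof -
    have "\<exists>\<delta>>0. \<forall>\<^sub>F n in sequentially. \<delta> \<le> prob (A n)"
      unfolding A_def
      by (rule tilting_lower_bound[where g = g and \<theta> = \<theta> and B = B]) fact+
    then show ?thesis using that by blast
  qed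
  define U where "U m = (\<Union>n\<in>{m..}. A n)" for m
  have U: "U m \<in> events" for m unfolding U_def by measurable
  have "\<delta> \<le> prob (U m)" for m
  proof -
    have "\<forall>\<^sub>F n in sequentially. \<delta> \<le> prob (A n) \<and> n \<ge> m"
      using \<delta>(2) by (simp add: eventually_conj_iff)
    then obtain n where n: "\<delta> \<le> prob (A n)" "n \<ge> m"
      using eventually_happens'[OF sequentially_bot] by blast
    note n(1)
    also have "prob (A n) \<le> prob (U m)"
      by (rule finite_measure_mono[OF _ U]) (use n in \<open>auto simp: U_def\<close>)
    finally show ?thesis .
  qed
  moreover have "(\<lambda>m. prob (U m)) \<longlonglongrightarrow> prob (\<Inter>m. U m)"
  proof (rule finite_Lim_measure_decseq)
    show "decseq U"
      unfolding U_def by (intro antimonoI UN_mono) auto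
  qed (use U in auto)
  ultimately have "\<delta> \<le> prob (\<Inter>m. U m)"
    by (intro LIMSEQ_le_const) auto
  also have "\<dots> \<le> prob T"
  proof (rule finite_measure_mono[OF _ T], rule subsetI)
    fix \<omega> assume \<omega>: "\<omega> \<in> (\<Inter>m. U m)"
    have "\<exists>\<^sub>F n in sequentially. \<forall>i\<in>I. real K \<le> (\<Sum>l=1..n. g i (X l \<omega>))" for K :: nat
      unfolding frequently_sequentially
    proof
      fix m
      from \<omega> have "\<omega> \<in> U (max m (K\<^sup>2))" by blast
      then obtain n where n: "n \<ge> m" "n \<ge> K\<^sup>2" "\<omega> \<in> A n" by (auto simp: U_def)
      have "real K \<le> sqrt (real n)"
        using n(2) by (intro real_le_rsqrt) (metis of_nat_le_iff of_nat_power)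
      with n show "\<exists>n\<ge>m. \<forall>i\<in>I. real K \<le> (\<Sum>l=1..n. g i (X l \<omega>))"
        by (intro exI[of _ n]) (auto simp: A_def intro: order_trans)
    qed
    moreover have "\<omega> \<in> space P"
      using \<omega> by (auto simp: U_def A_def)
    ultimately show "\<omega> \<in> T" by (simp add: T_def)
  qed
  finally have "prob T \<noteq> 0" using \<delta>(1) by simp
  then have "prob T = 1"
    using infinitely_often_above_all_levels_0_1[where g = g, OF I g] unfolding T_def by blast
  then have "AE \<omega> in P. \<omega> \<in> T" by (rule AE_prob_1)
  then show ?thesis
  proof eventually_elim
    case (elim \<omega>)
    then have "\<exists>\<^sub>F n in sequentially. \<forall>i\<in>I. real 0 \<le> (\<Sum>l=1..n. g i (X l \<omega>))"
      unfolding T_def by blast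
    then show ?case by simp
  qed
qed

text \<open>The centred indicator of an atom \<open>s\<close> of mass \<open>p\<close> has correlation \<open>p * g s\<close> with a centred \<open>g\<close>.
  Every linear combination of the values of \<open>g\<close> at atoms is therefore the correlation of \<open>g\<close> with a
  bounded centred function that does not depend on \<open>g\<close>.\<close>

lemma centred_indicator_combination:
  fixes c :: "'a \<Rightarrow> real"
  assumes N: "N = count_space V" and F: "finite F" "F \<subseteq> {s \<in> V. distribution_of P (X 1) s > 0}"
  defines "\<theta> \<equiv> \<lambda>x. \<Sum>s\<in>F. c s / distribution_of P (X 1) s * (indicator {s} x - distribution_of P (X 1) s)"
  shows "expectation (\<lambda>\<omega>. \<theta> (X 1 \<omega>)) = 0"
    and "\<bar>\<theta> x\<bar> \<le> (\<Sum>s\<in>F. \<bar>c s / distribution_of P (X 1) s\<bar> * (1 + \<bar>distribution_of P (X 1) s\<bar>))"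
    and "integrable P (\<lambda>\<omega>. g (X 1 \<omega>)) \<Longrightarrow> expectation (\<lambda>\<omega>. g (X 1 \<omega>)) = 0 \<Longrightarrow>
          expectation (\<lambda>\<omega>. \<theta> (X 1 \<omega>) * g (X 1 \<omega>)) = (\<Sum>s\<in>F. c s * g s)"
proof -
  let ?p = "distribution_of P (X 1)"
  have key: "integrable P (\<lambda>\<omega>. (indicator {s} (X 1 \<omega>) - ?p s) * h (X 1 \<omega>))"
      "expectation (\<lambda>\<omega>. (indicator {s} (X 1 \<omega>) - ?p s) * h (X 1 \<omega>))
        = ?p s * h s - ?p s * expectation (\<lambda>\<omega>. h (X 1 \<omega>))"
    if s: "s \<in> F" and h: "integrable P (\<lambda>\<omega>. h (X 1 \<omega>))" for s and h :: "'a \<Rightarrow> real"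
  proof -
    let ?S = "{\<omega> \<in> space P. X 1 \<omega> = s}"
    have "?S = X 1 -` {s} \<inter> space P" by auto
    then have S: "?S \<in> events"
      using measurable_sets[OF X_1_measurable, of "{s}"] s F N by auto
    have int_S: "integrable P (\<lambda>\<omega>. h s * indicator ?S \<omega>)"
      by (intro integrable_mult_right integrable_real_indicator S) (simp add: emeasure_eq_measure)
    have S_space: "?S \<inter> space P = ?S" by auto
    have eq: "(indicator {s} (X 1 \<omega>) - ?p s) * h (X 1 \<omega>) = h s * indicator ?S \<omega> - ?p s * h (X 1 \<omega>)"
      if "\<omega> \<in> space P" for \<omega>
      using that by (auto simp: indicator_def algebra_simps)
    show "integrable P (\<lambda>\<omega>. (indicator {s} (X 1 \<omega>) - ?p s) * h (X 1 \<omega>))"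
      using int_S h by (subst Bochner_Integration.integrable_cong[OF refl eq]) auto
    show "expectation (\<lambda>\<omega>. (indicator {s} (X 1 \<omega>) - ?p s) * h (X 1 \<omega>))
        = ?p s * h s - ?p s * expectation (\<lambda>\<omega>. h (X 1 \<omega>))"
      using int_S h by (subst Bochner_Integration.integral_cong[OF refl eq]) (simp_all add: S_space distribution_of_def)
  qed
  have \<theta>_h: "expectation (\<lambda>\<omega>. \<theta> (X 1 \<omega>) * h (X 1 \<omega>))
      = (\<Sum>s\<in>F. c s * (h s - expectation (\<lambda>\<omega>. h (X 1 \<omega>))))"
    if h: "integrable P (\<lambda>\<omega>. h (X 1 \<omega>))" for h :: "'a \<Rightarrow> real"
  proof -
    have "expectation (\<lambda>\<omega>. \<theta> (X 1 \<omega>) * h (X 1 \<omega>))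
        = expectation (\<lambda>\<omega>. \<Sum>s\<in>F. c s / ?p s * ((indicator {s} (X 1 \<omega>) - ?p s) * h (X 1 \<omega>)))"
      by (simp add: \<theta>_def sum_distrib_right mult.assoc)
    also have "\<dots> = (\<Sum>s\<in>F. c s / ?p s * expectation (\<lambda>\<omega>. (indicator {s} (X 1 \<omega>) - ?p s) * h (X 1 \<omega>)))"
      using key(1)[OF _ h] by (subst Bochner_Integration.integral_sum) auto
    also have "\<dots> = (\<Sum>s\<in>F. c s * (h s - expectation (\<lambda>\<omega>. h (X 1 \<omega>))))"
    proof (rule sum.cong[OF refl])
      fix s assume s: "s \<in> F"
      then have "?p s \<noteq> 0" using F by auto
      then show "c s / ?p s * expectation (\<lambda>\<omega>. (indicator {s} (X 1 \<omega>) - ?p s) * h (X 1 \<omega>))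
          = c s * (h s - expectation (\<lambda>\<omega>. h (X 1 \<omega>)))"
        unfolding key(2)[OF s h] by (simp add: field_simps)
    qed
    finally show ?thesis .
  qed
  show "expectation (\<lambda>\<omega>. \<theta> (X 1 \<omega>)) = 0"
    using \<theta>_h[of "\<lambda>_. 1"] by (simp add: prob_space)
  show "expectation (\<lambda>\<omega>. \<theta> (X 1 \<omega>) * g (X 1 \<omega>)) = (\<Sum>s\<in>F. c s * g s)"
    if "integrable P (\<lambda>\<omega>. g (X 1 \<omega>))" "expectation (\<lambda>\<omega>. g (X 1 \<omega>)) = 0"
    using \<theta>_h[OF that(1)] that(2) by simp
  show "\<bar>\<theta> x\<bar> \<le> (\<Sum>s\<in>F. \<bar>c s / ?p s\<bar> * (1 + \<bar>?p s\<bar>))"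
    unfolding \<theta>_def
  proof (rule order_trans[OF sum_abs sum_mono])
    fix s
    show "\<bar>c s / ?p s * (indicator {s} x - ?p s)\<bar> \<le> \<bar>c s / ?p s\<bar> * (1 + \<bar>?p s\<bar>)"
      unfolding abs_mult by (intro mult_left_mono) (auto simp: indicator_def)
  qed
qed

end

section \<open>Full-rank subgroups of \<open>\<int>\<^sup>m\<close>\<close>

lemma additive_int_scale:
  fixes \<phi> :: "('a \<Rightarrow> int) \<Rightarrow> int"
  assumes add: "\<And>x y. \<phi> (\<lambda>j. x j + y j) = \<phi> x + \<phi> y"
  shows "\<phi> (\<lambda>j. c * x j) = c * \<phi> x"
proof -
  have zero: "\<phi> (\<lambda>j. 0) = 0"
    using add[of "\<lambda>_. 0" "\<lambda>_. 0"] by simp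
  show ?thesis
  proof (induction c rule: int_induct[where k = 0])
    case base
    then show ?case using zero by simp
  next
    case (step1 c)
    then show ?case using add[of "\<lambda>j. c * x j" x] by (simp add: algebra_simps)
  next
    case (step2 c)
    then show ?case using add[of "\<lambda>j. (c - 1) * x j" x] by (simp add: algebra_simps)
  qed
qed

lemma additive_int_expand:
  fixes \<phi> :: "('a \<Rightarrow> int) \<Rightarrow> int"
  assumes add: "\<And>x y. \<phi> (\<lambda>j. x j + y j) = \<phi> x + \<phi> y" and "finite J"
  shows "\<phi> (\<lambda>i. if i \<in> J then z i else 0) = (\<Sum>j\<in>J. z j * \<phi> (\<lambda>i. if i = j then 1 else 0))"
  using \<open>finite J\<close>
proof (induction J)
  case empty
  then show ?case using additive_int_scale[of \<phi> 0 "\<lambda>_. 0", OF add] by simp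
next
  case (insert j J)
  have "(\<lambda>i. if i \<in> insert j J then z i else 0)
      = (\<lambda>i. (if i \<in> J then z i else 0) + z j * (if i = j then 1 else 0))"
    using insert.hyps by auto
  then have "\<phi> (\<lambda>i. if i \<in> insert j J then z i else 0)
      = \<phi> (\<lambda>i. if i \<in> J then z i else 0) + \<phi> (\<lambda>i. z j * (if i = j then 1 else 0))"
    using add by metis
  also have "\<phi> (\<lambda>i. z j * (if i = j then 1 else 0)) = z j * \<phi> (\<lambda>i. if i = j then 1 else 0)"
    by (rule additive_int_scale[OF add])
  finally show ?case using insert by simp
qed

lemma group_int_power_group: "group (int_power_group m)"
  by (simp add: int_power_group_def)

lemma carrier_int_power_group: "carrier (int_power_group m) = extensional {1..m}"
  by (auto simp: int_power_group_def PiE_def)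

lemma mult_int_power_group: "x \<otimes>\<^bsub>int_power_group m\<^esub> y = (\<lambda>j\<in>{1..m}. x j + y j)"
  by (simp add: int_power_group_def)

lemma generate_int_power_group_imp_combination:
  assumes "x \<in> generate (int_power_group m) (\<zeta> ` T)" and \<zeta>: "\<And>s. s \<in> T \<Longrightarrow> \<zeta> s \<in> extensional {1..m}"
  shows "\<exists>F c. finite F \<and> F \<subseteq> T \<and> (\<forall>j\<in>{1..m}. x j = (\<Sum>s\<in>F. c s * \<zeta> s j))"
  using assms(1)
proof induction
  case one
  then show ?case
    by (intro exI[of _ "{}"]) (simp add: int_power_group_def)
next
  case (incl h)
  then obtain s where s: "s \<in> T" "h = \<zeta> s" by blast
  then show ?case
    by (intro exI[of _ "{s}"] exI[of _ "\<lambda>_. 1"]) simp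
next
  case (inv h)
  then obtain s where s: "s \<in> T" "h = \<zeta> s" by blast
  moreover have "inv\<^bsub>int_power_group m\<^esub> (\<zeta> s) = (\<lambda>j\<in>{1..m}. - \<zeta> s j)"
    unfolding int_power_group_def using \<zeta>[OF s(1)] by (subst inv_product_group) (auto simp: PiE_def)
  ultimately show ?case
    by (intro exI[of _ "{s}"] exI[of _ "\<lambda>_. - 1"]) simp
next
  case (eng x y)
  then obtain F1 F2 c1 c2 where F: "finite F1" "F1 \<subseteq> T" "finite F2" "F2 \<subseteq> T"
    and x: "\<forall>j\<in>{1..m}. x j = (\<Sum>s\<in>F1. c1 s * \<zeta> s j)"
    and y: "\<forall>j\<in>{1..m}. y j = (\<Sum>s\<in>F2. c2 s * \<zeta> s j)" by blast
  define c where "c s = (if s \<in> F1 then c1 s else 0) + (if s \<in> F2 then c2 s else 0)" for s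
  have ext: "(\<Sum>s\<in>F. b s * \<zeta> s j) = (\<Sum>s\<in>F1 \<union> F2. (if s \<in> F then b s else 0) * \<zeta> s j)"
    if "F \<subseteq> F1 \<union> F2" for F b j
    using that F by (intro sum.mono_neutral_cong_left) auto
  have "(\<Sum>s\<in>F1. c1 s * \<zeta> s j) + (\<Sum>s\<in>F2. c2 s * \<zeta> s j) = (\<Sum>s\<in>F1 \<union> F2. c s * \<zeta> s j)" for j
    by (subst (1 2) ext) (simp_all add: c_def sum.distrib distrib_right)
  then show ?case
    using F x y by (intro exI[of _ "F1 \<union> F2"] exI[of _ c]) (auto simp: mult_int_power_group)
qed

text \<open>The isomorphism from \<open>\<int>\<^sup>m\<close> onto the subgroup is given by an integer matrix \<open>H\<close>. As it is injective,
  \<open>H\<close> has no nonzero integer vector in its kernel, so \<open>D = det H\<close> is nonzero. The subgroup is the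
  image of \<open>H\<close>, which contains \<open>det H * a = H (adj H a)\<close> for every integer vector \<open>a\<close>.\<close>

lemma full_rank_subgroup_contains_multiples:
  notes One_nat_def [simp del]
  assumes iso: "subgroup_generated (int_power_group m) S \<cong> int_power_group m"
  shows "\<exists>D. D \<noteq> 0 \<and> (\<forall>a. (\<lambda>j\<in>{1..m}. D * a j) \<in> generate (int_power_group m) (carrier (int_power_group m) \<inter> S))"
proof -
  let ?G = "int_power_group m" and ?I = "{1..m}"
  let ?A = "subgroup_generated ?G S"
  interpret group ?G by (rule group_int_power_group)
  have "?G \<cong> ?A"
    using group.iso_sym[OF group_subgroup_generated iso] .
  then obtain h where h: "h \<in> iso ?G ?A" by (auto simp: is_iso_def)
  have h_hom: "h (x \<otimes>\<^bsub>?G\<^esub> y) = h x \<otimes>\<^bsub>?G\<^esub> h y" if "x \<in> extensional ?I" "y \<in> extensional ?I" for x y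
    using h that hom_mult[of h ?G ?A] by (auto simp: iso_def carrier_int_power_group)
  have h_inj: "inj_on h (extensional ?I)" and h_carrier: "x \<in> extensional ?I \<Longrightarrow> h x \<in> carrier ?A" for x
    using h by (auto simp: iso_def bij_betw_def carrier_int_power_group)
  have A_sub: "carrier ?A \<subseteq> extensional ?I"
    using carrier_subgroup_generated_subset[of S] by (simp add: carrier_int_power_group)
  define e where "e j = (\<lambda>i\<in>?I. if i = j then 1 else (0::int))" for j
  have h_expand: "h z i = (\<Sum>j\<in>?I. z j * h (e j) i)" if z: "z \<in> extensional ?I" and i: "i \<in> ?I" for z i
  proof -
    define \<phi> where "\<phi> x = h (restrict x ?I) i" for x
    have add: "\<phi> (\<lambda>j. x j + y j) = \<phi> x + \<phi> y" for x y
    proof -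
      have "restrict (\<lambda>j. x j + y j) ?I = restrict x ?I \<otimes>\<^bsub>?G\<^esub> restrict y ?I"
        by (auto simp: mult_int_power_group)
      then have "\<phi> (\<lambda>j. x j + y j) = h (restrict x ?I \<otimes>\<^bsub>?G\<^esub> restrict y ?I) i"
        by (simp only: \<phi>_def)
      also have "\<dots> = (h (restrict x ?I) \<otimes>\<^bsub>?G\<^esub> h (restrict y ?I)) i"
        by (subst h_hom) auto
      also have "\<dots> = \<phi> x + \<phi> y"
        using i by (simp add: \<phi>_def mult_int_power_group)
      finally show ?thesis .
    qed
    have "restrict (\<lambda>i. if i \<in> ?I then z i else 0) ?I = z"
      using z by (auto simp: restrict_def extensional_def)
    then have "h z i = \<phi> (\<lambda>i. if i \<in> ?I then z i else 0)"
      by (simp only: \<phi>_def)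
    also have "\<dots> = (\<Sum>j\<in>?I. z j * \<phi> (\<lambda>i. if i = j then 1 else 0))"
      by (rule additive_int_expand[OF add]) simp
    finally show ?thesis by (simp add: \<phi>_def e_def)
  qed
  \<comment> \<open>The matrix is indexed from 0, the coordinates of \<open>\<int>\<^sup>m\<close>
    from 1; \<open>lift\<close> translates vectors.\<close>
  define H where "H = mat m m (\<lambda>(i, j). h (e (Suc j)) (Suc i))"
  have H: "H \<in> carrier_mat m m" by (simp add: H_def)
  define lift where "lift u = (\<lambda>j\<in>?I. vec_index u (j - 1))" for u :: "int vec"
  have lift_ext: "lift u \<in> extensional ?I" for u by (simp add: lift_def)
  have h_lift_ext: "h (lift u) \<in> extensional ?I" for u
    using A_sub h_carrier[OF lift_ext] by blast
  have H_mult: "h (lift u) i = vec_index (H *\<^sub>v u) (i - 1)" if u: "u \<in> carrier_vec m" and i: "i \<in> ?I" for u i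
  proof -
    have "h (lift u) i = (\<Sum>j\<in>?I. vec_index u (j - 1) * h (e j) i)"
      using h_expand[OF lift_ext i] by (simp add: lift_def)
    also have "\<dots> = (\<Sum>j<m. vec_index u j * h (e (Suc j)) i)"
      by (rule sum.reindex_bij_witness[of _ Suc "\<lambda>j. j - 1"]) auto
    also have "\<dots> = vec_index (H *\<^sub>v u) (i - 1)"
    proof -
      obtain i' where "i = Suc i'" "i' < m" using i by (cases i) auto
      then show ?thesis
        using u by (auto simp: H_def scalar_prod_def mult.commute lessThan_atLeast0 intro!: sum.cong)
    qed
    finally show ?thesis .
  qed
  have "det H \<noteq> 0"
  proof
    assume "det H = 0"
    then obtain u where u: "u \<in> carrier_vec m" "u \<noteq> 0\<^sub>v m" "H *\<^sub>v u = 0\<^sub>v m"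
      using det_0_iff_vec_prod_zero[OF H] by blast
    have "h (lift u) i = h (lift (0\<^sub>v m)) i" for i
    proof (cases "i \<in> ?I")
      case True
      have "H *\<^sub>v 0\<^sub>v m = 0\<^sub>v m" using H by auto
      then show ?thesis
        using H_mult[OF u(1) True] H_mult[OF zero_carrier_vec True] u(3) by simp
    next
      case False
      then show ?thesis
        by (simp only: extensional_arb[OF h_lift_ext False])
    qed
    then have "lift u = lift (0\<^sub>v m)"
      using h_inj lift_ext by (auto simp: inj_on_def fun_eq_iff)
    then have lift_eq: "lift u (Suc j) = lift (0\<^sub>v m) (Suc j)" for j by simp
    have "vec_index u j = 0" if "j < m" for j
      using lift_eq[of j] that by (simp add: lift_def)
    with u show False by (auto intro!: eq_vecI)
  qed
  moreover have "(\<lambda>j\<in>?I. det H * a j) \<in> generate ?G (carrier ?G \<inter> S)" for a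
  proof -
    define b :: "int vec" where "b = vec m (\<lambda>i. a (Suc i))"
    define u where "u = adj_mat H *\<^sub>v b"
    have b: "b \<in> carrier_vec m" by (simp add: b_def)
    have u: "u \<in> carrier_vec m" unfolding u_def by (rule mult_mat_vec_carrier[OF adj_mat(1)[OF H] b])
    have "H *\<^sub>v u = (H * adj_mat H) *\<^sub>v b"
      unfolding u_def using assoc_mult_mat_vec[OF H adj_mat(1)[OF H] b] by simp
    also have "\<dots> = det H \<cdot>\<^sub>v b"
      unfolding adj_mat(2)[OF H] using b by (intro eq_vecI) auto
    finally have Hu: "H *\<^sub>v u = det H \<cdot>\<^sub>v b" .
    have "h (lift u) = (\<lambda>j\<in>?I. det H * a j)"
    proof
      fix i
      show "h (lift u) i = (\<lambda>j\<in>?I. det H * a j) i"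
      proof (cases "i \<in> ?I")
        case True
        then show ?thesis using H_mult[OF u True] by (auto simp: Hu b_def)
      next
        case False
        then show ?thesis by (simp only: extensional_arb[OF h_lift_ext False] restrict_def if_False)
      qed
    qed
    then show ?thesis
      using h_carrier[OF lift_ext[of u]] by (simp add: carrier_subgroup_generated)
  qed
  ultimately show ?thesis by blast
qed

lemma genuinely_dimensional_imp_increments_span:
  assumes "walk_genuinely_dimensional V E v k \<mu> (k - 1)"
  shows "\<exists>F c. finite F \<and> F \<subseteq> {s \<in> V. \<mu> s > 0} \<and>
    (\<forall>j\<in>{1..k - 1}. (\<Sum>s\<in>F. c s * real_of_int (walk_increment V E v k s j)) = real_of_int (a j))"
proof -
  let ?G = "int_power_group (k - 1)" and ?T = "{s \<in> V. \<mu> s > 0}"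
  have "subgroup_generated ?G (walk_increment V E v k ` ?T) \<cong> ?G"
    using assms by (simp only: walk_genuinely_dimensional_def walk_group_def)
  from full_rank_subgroup_contains_multiples[OF this]
  obtain D where "D \<noteq> 0" and D: "(\<lambda>j\<in>{1..k - 1}. D * a j) \<in> generate ?G (carrier ?G \<inter> walk_increment V E v k ` ?T)"
    by blast
  have ext: "walk_increment V E v k s \<in> extensional {1..k - 1}" for s
    by (simp add: walk_increment_def)
  then have "carrier ?G \<inter> walk_increment V E v k ` ?T = walk_increment V E v k ` ?T"
    by (auto simp: carrier_int_power_group)
  with D have "(\<lambda>j\<in>{1..k - 1}. D * a j) \<in> generate ?G (walk_increment V E v k ` ?T)"
    by (simp only:)
  from generate_int_power_group_imp_combination[OF this ext]
  obtain F c where F: "finite F" "F \<subseteq> ?T"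
    and c: "\<forall>j\<in>{1..k - 1}. (\<lambda>j\<in>{1..k - 1}. D * a j) j = (\<Sum>s\<in>F. c s * walk_increment V E v k s j)"
    by (elim exE conjE)
  have "(\<Sum>s\<in>F. (real_of_int (c s) / real_of_int D) * real_of_int (walk_increment V E v k s j)) = real_of_int (a j)"
    if j: "j \<in> {1..k - 1}" for j
  proof -
    have "(\<Sum>s\<in>F. (real_of_int (c s) / real_of_int D) * real_of_int (walk_increment V E v k s j))
        = real_of_int (\<Sum>s\<in>F. c s * walk_increment V E v k s j) / real_of_int D"
      by (simp add: sum_divide_distrib)
    also have "(\<Sum>s\<in>F. c s * walk_increment V E v k s j) = D * a j"
      using c j by simp
    finally show ?thesis using \<open>D \<noteq> 0\<close> by simp
  qed
  then show ?thesis using F by (intro exI[of _ F] exI[of _ "\<lambda>s. real_of_int (c s) / real_of_int D"]) auto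
qed

section \<open>Distances in connected locally finite graphs\<close>

locale connected_locally_finite_graph =
  fixes V :: "'v set" and E :: "'v set set"
  assumes locally_finite: "locally_finite V E"
    and connected: "graph_connected V E"
begin

abbreviation d :: "'v \<Rightarrow> 'v \<Rightarrow> nat" where
  "d \<equiv> graph_dist V E"

lemma adjacency_sym: "(u, v) \<in> adjacency V E \<Longrightarrow> (v, u) \<in> adjacency V E"
  by (auto simp: adjacency_def insert_commute)

lemma walk_sym: "(u, v) \<in> adjacency V E ^^ n \<Longrightarrow> (v, u) \<in> adjacency V E ^^ n"
proof (induction n arbitrary: v)
  case (Suc n)
  then obtain w where "(u, w) \<in> adjacency V E ^^ n" "(w, v) \<in> adjacency V E" by auto
  then show ?case using Suc.IH adjacency_sym by (blast intro: relpow_Suc_I2)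
qed auto

lemma shortest_walk: "u \<in> V \<Longrightarrow> v \<in> V \<Longrightarrow> (u, v) \<in> adjacency V E ^^ d u v"
  unfolding graph_dist_def
  by (rule LeastI_ex) (use connected in \<open>auto simp: graph_connected_def intro: rtrancl_imp_relpow\<close>)

lemma dist_le_walk: "(u, v) \<in> adjacency V E ^^ n \<Longrightarrow> d u v \<le> n"
  unfolding graph_dist_def by (rule Least_le)

lemma dist_sym: "u \<in> V \<Longrightarrow> v \<in> V \<Longrightarrow> d u v = d v u"
  by (meson antisym dist_le_walk shortest_walk walk_sym)

lemma dist_triangle: "u \<in> V \<Longrightarrow> v \<in> V \<Longrightarrow> w \<in> V \<Longrightarrow> d u w \<le> d u v + d v w"
  using shortest_walk[of u v] shortest_walk[of v w]
  by (intro dist_le_walk) (auto simp: relpow_add)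

lemma finite_neighbours: "finite (adjacency V E `` {x})"
proof (cases "x \<in> V")
  case True
  then have "finite {e \<in> E. x \<in> e}"
    using locally_finite by (auto simp: locally_finite_def)
  moreover have "(\<lambda>u. {x, u}) ` (adjacency V E `` {x}) \<subseteq> {e \<in> E. x \<in> e}"
    by (auto simp: adjacency_def)
  moreover have "inj_on (\<lambda>u. {x, u}) (adjacency V E `` {x})"
    by (auto simp: inj_on_def doubleton_eq_iff)
  ultimately show ?thesis
    by (meson finite_imageD finite_subset)
next
  case False
  then have "adjacency V E `` {x} = {}" by (auto simp: adjacency_def)
  then show ?thesis by simp
qed

lemma finite_sphere: "finite ((adjacency V E ^^ n) `` {x})"
proof (induction n)
  case (Suc n)
  have "(adjacency V E ^^ Suc n) `` {x} = (\<Union>y\<in>(adjacency V E ^^ n) `` {x}. adjacency V E `` {y})"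
    by auto
  then show ?case using Suc finite_neighbours by simp
qed auto

lemma finite_ball:
  assumes "x \<in> V"
  shows "finite {u \<in> V. d u x \<le> n}"
proof (rule finite_subset)
  show "{u \<in> V. d u x \<le> n} \<subseteq> (\<Union>k\<le>n. (adjacency V E ^^ k) `` {x})"
    using shortest_walk[OF assms] dist_sym[OF assms] by force
qed (simp add: finite_sphere)

lemma countable_vertices: "countable V"
proof (cases "V = {}")
  case False
  then obtain x where x: "x \<in> V" by blast
  have "V \<subseteq> (\<Union>n. {u \<in> V. d u x \<le> n})" by auto
  moreover have "countable (\<Union>n. {u \<in> V. d u x \<le> n})"
    by (intro countable_UN countable_finite finite_ball[OF x] countableI_type)
  ultimately show ?thesis by (rule countable_subset)
qed simp

text \<open>The triangle inequality bounds \<open>d u s\<close> below by the absolute value of \<open>d u x - d x s\<close>; squaring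
  gives an estimate that is linear in \<open>d x s\<close>.\<close>

lemma dist_square_growth:
  assumes "u \<in> V" "x \<in> V" "s \<in> V"
  shows "real (d u x) * (real (d u x) - 2 * real (d x s)) \<le> (real (d u s))\<^sup>2 - (real (d x s))\<^sup>2"
proof -
  have "d u x \<le> d u s + d x s" "d x s \<le> d u x + d u s"
    using dist_triangle[of u s x] dist_triangle[of x u s] dist_sym assms by simp_all
  then have "\<bar>real (d u x) - real (d x s)\<bar> \<le> \<bar>real (d u s)\<bar>" by linarith
  then have "(real (d u x) - real (d x s))\<^sup>2 \<le> (real (d u s))\<^sup>2"
    by (simp only: abs_le_square_iff)
  then show ?thesis by (simp add: power2_eq_square algebra_simps)
qed

lemma dist_square_difference_bound:
  assumes "u \<in> V" "x \<in> V" "s \<in> V"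
  shows "\<bar>(real (d u s))\<^sup>2 - (real (d x s))\<^sup>2\<bar> \<le> real (d u x) * (real (d u x) + 2 * real (d x s))"
proof -
  have "real (d u s) \<le> real (d u x) + real (d x s)"
    using dist_triangle[of u x s] assms by (simp flip: of_nat_add)
  then have "(real (d u s))\<^sup>2 \<le> (real (d u x) + real (d x s))\<^sup>2"
    by (intro power_mono) auto
  then have "(real (d u s))\<^sup>2 - (real (d x s))\<^sup>2 \<le> real (d u x) * (real (d u x) + 2 * real (d x s))"
    by (simp add: power2_eq_square algebra_simps)
  moreover have "- (real (d u x) * (real (d u x) + 2 * real (d x s)))
      \<le> real (d u x) * (real (d u x) - 2 * real (d x s))"
    by (simp add: algebra_simps)
  ultimately show ?thesis
    using dist_square_growth[OF assms] by linarith
qed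

end

section \<open>Mean-sets and sample mean-sets\<close>

text \<open>Finite subsets of \<open>V\<close> give partial sums of the left-hand side, and these are the integrals over the
  event that \<open>X\<close> lies in the finite set. Countability of \<open>V\<close> allows an exhaustion by a sequence of
  such sets, and hence monotone convergence.\<close>

lemma infsum_distribution_eq_nn_integral:
  assumes X: "X \<in> measurable P (count_space V)" and V: "countable V"
    and P: "prob_space P" and f: "\<And>s. f s \<ge> 0"
  shows "(\<Sum>\<^sub>\<infinity>s\<in>V. ennreal (f s * distribution_of P X s)) = (\<integral>\<^sup>+\<omega>. ennreal (f (X \<omega>)) \<partial>P)"
proof -
  interpret prob_space P by (rule P)
  note [measurable] = X
  let ?g = "\<lambda>s. ennreal (f s * distribution_of P X s)"
  have sum_eq: "sum ?g F = (\<integral>\<^sup>+\<omega>. ennreal (f (X \<omega>)) * indicator F (X \<omega>) \<partial>P)"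
    if F: "finite F" "F \<subseteq> V" for F
  proof -
    have meas: "{\<omega> \<in> space P. X \<omega> = s} \<in> events" if "s \<in> F" for s
      using measurable_sets[OF X, of "{s}"] that F by (auto simp: vimage_def Int_def conj_commute)
    have "?g s = (\<integral>\<^sup>+\<omega>. ennreal (f s) * indicator {\<omega> \<in> space P. X \<omega> = s} \<omega> \<partial>P)" if "s \<in> F" for s
      using meas[OF that] f
      by (simp add: nn_integral_cmult_indicator emeasure_eq_measure distribution_of_def ennreal_mult)
    then have "sum ?g F = (\<Sum>s\<in>F. \<integral>\<^sup>+\<omega>. ennreal (f s) * indicator {\<omega> \<in> space P. X \<omega> = s} \<omega> \<partial>P)"
      by (rule sum.cong[OF refl])
    also have "\<dots> = (\<integral>\<^sup>+\<omega>. (\<Sum>s\<in>F. ennreal (f s) * indicator {\<omega> \<in> space P. X \<omega> = s} \<omega>) \<partial>P)"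
      by (intro nn_integral_sum[symmetric] borel_measurable_times_ennreal borel_measurable_indicator meas) auto
    also have "\<dots> = (\<integral>\<^sup>+\<omega>. ennreal (f (X \<omega>)) * indicator F (X \<omega>) \<partial>P)"
    proof (rule nn_integral_cong)
      fix \<omega> assume \<omega>: "\<omega> \<in> space P"
      have "(\<Sum>s\<in>F. ennreal (f s) * indicator {\<omega> \<in> space P. X \<omega> = s} \<omega>)
          = (\<Sum>s\<in>F. if s = X \<omega> then ennreal (f (X \<omega>)) else 0)"
        by (rule sum.cong) (use \<omega> in auto)
      also have "\<dots> = ennreal (f (X \<omega>)) * indicator F (X \<omega>)"
        using F by (simp add: indicator_def)
      finally show "(\<Sum>s\<in>F. ennreal (f s) * indicator {\<omega> \<in> space P. X \<omega> = s} \<omega>)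
          = ennreal (f (X \<omega>)) * indicator F (X \<omega>)" .
    qed
    finally show ?thesis .
  qed
  have infsum: "(\<Sum>\<^sub>\<infinity>s\<in>V. ?g s) = (SUP F\<in>{F. finite F \<and> F \<subseteq> V}. sum ?g F)"
    by (rule nonneg_infsum_complete) simp
  show ?thesis
  proof (rule antisym)
    show "(\<Sum>\<^sub>\<infinity>s\<in>V. ?g s) \<le> (\<integral>\<^sup>+\<omega>. ennreal (f (X \<omega>)) \<partial>P)"
      unfolding infsum
    proof (rule SUP_least)
      fix F assume "F \<in> {F. finite F \<and> F \<subseteq> V}"
      then show "sum ?g F \<le> (\<integral>\<^sup>+\<omega>. ennreal (f (X \<omega>)) \<partial>P)"
        by (auto simp: sum_eq intro!: nn_integral_mono split: split_indicator)
    qed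
  next
    define F where "F n = V \<inter> from_nat_into V ` {..<n}" for n :: nat
    have F: "finite (F n)" "F n \<subseteq> V" for n by (auto simp: F_def)
    have "(\<integral>\<^sup>+\<omega>. ennreal (f (X \<omega>)) \<partial>P)
        = (\<integral>\<^sup>+\<omega>. (SUP n. ennreal (f (X \<omega>)) * indicator (F n) (X \<omega>)) \<partial>P)"
    proof (rule nn_integral_cong)
      fix \<omega> assume "\<omega> \<in> space P"
      then have "X \<omega> \<in> V" using measurable_space[OF X] by simp
      then have "X \<omega> \<in> F (Suc (to_nat_on V (X \<omega>)))"
        using V by (auto simp: F_def intro!: image_eqI[of _ _ "to_nat_on V (X \<omega>)"])
      then have "ennreal (f (X \<omega>)) \<le> (SUP n. ennreal (f (X \<omega>)) * indicator (F n) (X \<omega>))"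
        by (intro SUP_upper2[of "Suc (to_nat_on V (X \<omega>))"]) auto
      moreover have "(SUP n. ennreal (f (X \<omega>)) * indicator (F n) (X \<omega>)) \<le> ennreal (f (X \<omega>))"
        by (rule SUP_least) (auto split: split_indicator)
      ultimately show "ennreal (f (X \<omega>)) = (SUP n. ennreal (f (X \<omega>)) * indicator (F n) (X \<omega>))"
        by (rule antisym)
    qed
    also have "\<dots> = (SUP n. \<integral>\<^sup>+\<omega>. ennreal (f (X \<omega>)) * indicator (F n) (X \<omega>) \<partial>P)"
    proof (rule nn_integral_monotone_convergence_SUP)
      show "incseq (\<lambda>n \<omega>. ennreal (f (X \<omega>)) * indicator (F n) (X \<omega>))"
        by (auto simp: incseq_def le_fun_def F_def split: split_indicator)
      show "(\<lambda>\<omega>. ennreal (f (X \<omega>)) * indicator (F n) (X \<omega>)) \<in> borel_measurable P" for n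
        by (rule measurable_compose[OF X]) simp
    qed
    also have "\<dots> = (SUP n. sum ?g (F n))"
      using F by (simp add: sum_eq)
    also have "\<dots> \<le> (\<Sum>\<^sub>\<infinity>s\<in>V. ?g s)"
      unfolding infsum by (rule SUP_least, rule SUP_upper) (use F in auto)
    finally show "(\<integral>\<^sup>+\<omega>. ennreal (f (X \<omega>)) \<partial>P) \<le> (\<Sum>\<^sub>\<infinity>s\<in>V. ?g s)" .
  qed
qed

lemma infsum_sample_freq_eq_average:
  assumes x: "\<And>i. i \<in> {1..n} \<Longrightarrow> x i \<in> V" and f: "\<And>s. f s \<ge> 0"
  shows "(\<Sum>\<^sub>\<infinity>s\<in>V. ennreal (f s * sample_freq x n s)) = ennreal ((\<Sum>i=1..n. f (x i)) / real n)"
proof -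
  have "(\<Sum>\<^sub>\<infinity>s\<in>V. ennreal (f s * sample_freq x n s))
      = (\<Sum>\<^sub>\<infinity>s\<in>x ` {1..n}. ennreal (f s * sample_freq x n s))"
  proof (rule infsum_cong_neutral)
    fix s assume "s \<in> V - x ` {1..n}"
    then have "{i \<in> {1..n}. x i = s} = {}" by auto
    then show "ennreal (f s * sample_freq x n s) = 0"
      unfolding sample_freq_def by (metis card.empty ennreal_0 mult_zero_right of_nat_0)
  qed (use x in auto)
  also have "\<dots> = ennreal (\<Sum>s\<in>x ` {1..n}. f s * sample_freq x n s)"
    using f by (simp add: sum_ennreal sample_freq_def)
  also have "(\<Sum>s\<in>x ` {1..n}. f s * sample_freq x n s)
      = (\<Sum>s\<in>x ` {1..n}. \<Sum>i | i \<in> {1..n} \<and> x i = s. f (x i)) / real n"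
    by (simp add: sample_freq_def sum_divide_distrib mult.commute)
  also have "(\<Sum>s\<in>x ` {1..n}. \<Sum>i | i \<in> {1..n} \<and> x i = s. f (x i)) = (\<Sum>i=1..n. f (x i))"
    by (rule sum.image_gen[symmetric]) simp
  finally show ?thesis .
qed

locale random_vertex_sequence =
  connected_locally_finite_graph V E + iid_sequence P "count_space V" \<xi>
  for V :: "'v set" and E :: "'v set set" and P :: "'w measure" and \<xi> :: "nat \<Rightarrow> 'w \<Rightarrow> 'v" +
  assumes totally_defined: "weight_totally_defined V E (distribution_of P (\<xi> 1))"
begin

abbreviation \<mu> :: "'v \<Rightarrow> real" where
  "\<mu> \<equiv> distribution_of P (\<xi> 1)"

definition sqdist :: "'v \<Rightarrow> 'v \<Rightarrow> real" where
  "sqdist u s = (real (d u s))\<^sup>2"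

definition mean_sqdist :: "'v \<Rightarrow> real" where
  "mean_sqdist u = expectation (\<lambda>\<omega>. sqdist u (\<xi> 1 \<omega>))"

lemma sqdist_nonneg: "sqdist u s \<ge> 0"
  by (simp add: sqdist_def)

lemma \<xi>_in_V: "i \<ge> 1 \<Longrightarrow> \<omega> \<in> space P \<Longrightarrow> \<xi> i \<omega> \<in> V"
  using measurable_space[OF X_measurable[of i]] by simp

lemma \<xi>_1_in_V: "\<omega> \<in> space P \<Longrightarrow> \<xi> 1 \<omega> \<in> V"
  by (rule \<xi>_in_V) simp

lemma measurable_function_of_\<xi>: "(\<lambda>\<omega>. f (\<xi> 1 \<omega>)) \<in> borel_measurable P"
  for f :: "'v \<Rightarrow> real"
  by (rule measurable_compose[OF X_1_measurable]) simp

lemma weight_eq_nn_integral: "weight V E \<mu> u = (\<integral>\<^sup>+\<omega>. ennreal (sqdist u (\<xi> 1 \<omega>)) \<partial>P)"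
  unfolding weight_def sqdist_def[symmetric]
  by (rule infsum_distribution_eq_nn_integral[OF X_1_measurable countable_vertices])
     (auto simp: sqdist_nonneg prob_space_axioms)

lemma integrable_sqdist:
  assumes "u \<in> V"
  shows "integrable P (\<lambda>\<omega>. sqdist u (\<xi> 1 \<omega>))"
proof (rule integrableI_nonneg)
  show "(\<integral>\<^sup>+\<omega>. ennreal (sqdist u (\<xi> 1 \<omega>)) \<partial>P) < \<infinity>"
    using totally_defined assms unfolding weight_totally_defined_def weight_eq_nn_integral by blast
qed (simp_all add: measurable_function_of_\<xi> sqdist_nonneg)

lemma weight_eq_mean_sqdist: "u \<in> V \<Longrightarrow> weight V E \<mu> u = ennreal (mean_sqdist u)"
  unfolding weight_eq_nn_integral mean_sqdist_def
  by (rule nn_integral_eq_integral) (auto simp: integrable_sqdist sqdist_nonneg)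

lemma mean_sqdist_nonneg: "mean_sqdist u \<ge> 0"
  unfolding mean_sqdist_def by (intro integral_nonneg_AE) (simp add: sqdist_nonneg)

lemma mem_mean_set_iff:
  "u \<in> mean_set V E \<mu> \<longleftrightarrow> u \<in> V \<and> (\<forall>w\<in>V. mean_sqdist u \<le> mean_sqdist w)"
  unfolding mean_set_def
  using weight_eq_mean_sqdist mean_sqdist_nonneg by (auto simp: ennreal_le_iff)

lemma mem_sample_mean_set_iff:
  assumes x: "\<And>i. i \<in> {1..n} \<Longrightarrow> x i \<in> V" and n: "n \<ge> 1"
  shows "u \<in> sample_mean_set V E x n \<longleftrightarrow>
    u \<in> V \<and> (\<forall>w\<in>V. (\<Sum>i=1..n. sqdist u (x i)) \<le> (\<Sum>i=1..n. sqdist w (x i)))"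
proof -
  have "weight V E (sample_freq x n) w = ennreal ((\<Sum>i=1..n. sqdist w (x i)) / real n)" for w
    unfolding weight_def sqdist_def[symmetric]
    by (rule infsum_sample_freq_eq_average[OF x sqdist_nonneg])
  moreover have "0 \<le> (\<Sum>i=1..n. sqdist w (x i)) / real n" for w
    by (intro divide_nonneg_nonneg sum_nonneg sqdist_nonneg) auto
  ultimately show ?thesis
    unfolding sample_mean_set_def mean_set_def
    using n by (simp add: ennreal_le_iff divide_le_cancel)
qed

text \<open>The squared distance itself need only be integrable, but the quadratic terms cancel in the
  difference, which grows at most linearly with the distance.\<close>

lemma integrable_sqdist_difference_square:
  assumes u: "u \<in> V" and x: "x \<in> V"
  shows "integrable P (\<lambda>\<omega>. (sqdist u (\<xi> 1 \<omega>) - sqdist x (\<xi> 1 \<omega>))\<^sup>2)"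
proof (rule Bochner_Integration.integrable_bound)
  let ?a = "real (d u x)"
  show "integrable P (\<lambda>\<omega>. ?a\<^sup>2 * (2 * ?a\<^sup>2 + 8 * sqdist x (\<xi> 1 \<omega>)))"
    using integrable_sqdist[OF x] by simp
  show "(\<lambda>\<omega>. (sqdist u (\<xi> 1 \<omega>) - sqdist x (\<xi> 1 \<omega>))\<^sup>2) \<in> borel_measurable P"
    by (rule measurable_function_of_\<xi>)
  have "(sqdist u s - sqdist x s)\<^sup>2 \<le> ?a\<^sup>2 * (2 * ?a\<^sup>2 + 8 * sqdist x s)" if s: "s \<in> V" for s
  proof -
    let ?t = "real (d x s)"
    have "\<bar>sqdist u s - sqdist x s\<bar>\<^sup>2 \<le> (?a * (?a + 2 * ?t))\<^sup>2"
      unfolding sqdist_def using dist_square_difference_bound[OF u x s] by (intro power_mono) auto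
    also have "\<dots> = ?a\<^sup>2 * (?a + 2 * ?t)\<^sup>2"
      by (simp add: power_mult_distrib)
    also have "\<dots> \<le> ?a\<^sup>2 * (2 * ?a\<^sup>2 + 8 * sqdist x s)"
    proof (rule mult_left_mono)
      have "2 * ?a\<^sup>2 + 8 * ?t\<^sup>2 - (?a + 2 * ?t)\<^sup>2 = (?a - 2 * ?t)\<^sup>2"
        by (simp add: power2_eq_square algebra_simps)
      then show "(?a + 2 * ?t)\<^sup>2 \<le> 2 * ?a\<^sup>2 + 8 * sqdist x s"
        unfolding sqdist_def by (metis diff_ge_0_iff_ge zero_le_power2)
    qed simp
    finally show ?thesis by simp
  qed
  then show "AE \<omega> in P. norm ((sqdist u (\<xi> 1 \<omega>) - sqdist x (\<xi> 1 \<omega>))\<^sup>2)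
      \<le> norm (?a\<^sup>2 * (2 * ?a\<^sup>2 + 8 * sqdist x (\<xi> 1 \<omega>)))"
    using \<xi>_1_in_V by (intro AE_I2) (auto simp: sqdist_nonneg abs_of_nonneg)
qed

text \<open>The law of large numbers is needed only finitely often: once for the average distance from \<open>x\<close>,
  which makes \<open>dist_square_growth\<close> exclude all vertices at distance more than \<open>2 * C\<close> simultaneously,
  and once for each of the vertices in the remaining ball.\<close>

lemma AE_eventually_mean_set_beats_others:
  assumes x: "x \<in> mean_set V E \<mu>"
  shows "AE \<omega> in P. \<forall>\<^sub>F n in sequentially. \<forall>u\<in>V - mean_set V E \<mu>.
           (\<Sum>i=1..n. sqdist x (\<xi> i \<omega>)) < (\<Sum>i=1..n. sqdist u (\<xi> i \<omega>))"
proof -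
  have xV: "x \<in> V" using x by (simp add: mem_mean_set_iff)
  have int_d: "integrable P (\<lambda>\<omega>. real (d x (\<xi> 1 \<omega>)))"
    by (rule square_integrable_imp_integrable_1)
       (use integrable_sqdist[OF xV] in \<open>simp_all add: sqdist_def\<close>)
  define C where "C = expectation (\<lambda>\<omega>. real (d x (\<xi> 1 \<omega>))) + 1"
  define near where "near = {u \<in> V. d u x \<le> nat \<lceil>2 * C\<rceil>} - mean_set V E \<mu>"
  have "finite near" unfolding near_def using finite_ball[OF xV] by simp
  have far: "AE \<omega> in P. \<forall>\<^sub>F n in sequentially. (\<Sum>i=1..n. C - real (d x (\<xi> i \<omega>))) > 0"
  proof (rule AE_eventually_sum_pos)
    have "integrable P (\<lambda>\<omega>. C\<^sup>2 - 2 * C * real (d x (\<xi> 1 \<omega>)) + sqdist x (\<xi> 1 \<omega>))"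
      using int_d integrable_sqdist[OF xV] by simp
    then show "integrable P (\<lambda>\<omega>. (C - real (d x (\<xi> 1 \<omega>)))\<^sup>2)"
      by (simp add: sqdist_def power2_diff algebra_simps)
    show "expectation (\<lambda>\<omega>. C - real (d x (\<xi> 1 \<omega>))) > 0"
      using int_d by (simp add: C_def prob_space)
  qed simp
  have "AE \<omega> in P. \<forall>\<^sub>F n in sequentially. (\<Sum>i=1..n. sqdist u (\<xi> i \<omega>) - sqdist x (\<xi> i \<omega>)) > 0"
    if u: "u \<in> near" for u
  proof (rule AE_eventually_sum_pos)
    have uV: "u \<in> V" "u \<notin> mean_set V E \<mu>" using u by (auto simp: near_def)
    show "integrable P (\<lambda>\<omega>. (sqdist u (\<xi> 1 \<omega>) - sqdist x (\<xi> 1 \<omega>))\<^sup>2)"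
      by (rule integrable_sqdist_difference_square[OF uV(1) xV])
    have "mean_sqdist x < mean_sqdist u"
      using x uV unfolding mem_mean_set_iff by (meson not_le order_trans)
    then show "expectation (\<lambda>\<omega>. sqdist u (\<xi> 1 \<omega>) - sqdist x (\<xi> 1 \<omega>)) > 0"
      using integrable_sqdist[OF xV] integrable_sqdist[OF uV(1)] by (simp add: mean_sqdist_def)
  qed simp
  then have "AE \<omega> in P. \<forall>u\<in>near. \<forall>\<^sub>F n in sequentially.
      (\<Sum>i=1..n. sqdist u (\<xi> i \<omega>) - sqdist x (\<xi> i \<omega>)) > 0"
    using \<open>finite near\<close> by (intro AE_finite_allI)
  with far AE_space show ?thesis
  proof eventually_elim
    case (elim \<omega>)
    have "\<forall>\<^sub>F n in sequentially. \<forall>u\<in>near. (\<Sum>i=1..n. sqdist u (\<xi> i \<omega>) - sqdist x (\<xi> i \<omega>)) > 0"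
      using elim(3) \<open>finite near\<close> by (simp add: eventually_ball_finite)
    with elim(1) show ?case
    proof eventually_elim
      case (elim n)
      show ?case
      proof
        fix u assume u: "u \<in> V - mean_set V E \<mu>"
        have "(\<Sum>i=1..n. sqdist u (\<xi> i \<omega>) - sqdist x (\<xi> i \<omega>)) > 0"
        proof (cases "u \<in> near")
          case True
          then show ?thesis using elim(2) by blast
        next
          case False
          let ?a = "real (d u x)"
          have "d u x > nat \<lceil>2 * C\<rceil>" using False u by (auto simp: near_def)
          then have a: "?a > 2 * C" "?a > 0" by linarith+
          have "0 < ?a * (2 * (\<Sum>i=1..n. C - real (d x (\<xi> i \<omega>))))"
            using elim(1) a by simp
          also have "\<dots> = (\<Sum>i=1..n. ?a * (2 * C - 2 * real (d x (\<xi> i \<omega>))))"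
            by (simp add: sum_distrib_left right_diff_distrib)
          also have "\<dots> \<le> (\<Sum>i=1..n. sqdist u (\<xi> i \<omega>) - sqdist x (\<xi> i \<omega>))"
          proof (rule sum_mono)
            fix i assume "i \<in> {1..n}"
            then have s: "\<xi> i \<omega> \<in> V" using \<xi>_in_V \<open>\<omega> \<in> space P\<close> by simp
            have "?a * (2 * C - 2 * real (d x (\<xi> i \<omega>))) \<le> ?a * (?a - 2 * real (d x (\<xi> i \<omega>)))"
              using a by (intro mult_left_mono) auto
            also have "\<dots> \<le> sqdist u (\<xi> i \<omega>) - sqdist x (\<xi> i \<omega>)"
              unfolding sqdist_def using u s by (intro dist_square_growth xV) auto
            finally show "?a * (2 * C - 2 * real (d x (\<xi> i \<omega>)))
                \<le> sqdist u (\<xi> i \<omega>) - sqdist x (\<xi> i \<omega>)" .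
          qed
          finally show ?thesis .
        qed
        then show "(\<Sum>i=1..n. sqdist x (\<xi> i \<omega>)) < (\<Sum>i=1..n. sqdist u (\<xi> i \<omega>))"
          by (simp add: sum_subtractf)
      qed
    qed
  qed
qed

text \<open>The walk compares every mean vertex with \<open>v 1\<close>, whereas the differences needed here are taken with
  respect to \<open>v j\<close>. Since the increments span, the correlations with
  \<open>sqdist (v i) - sqdist (v 1)\<close> can be prescribed as \<open>b i\<close>, subject only to \<open>b 1 = 0\<close>, and \<open>b\<close> is
  chosen with \<open>b i - b j = 1\<close> for all \<open>i \<noteq> j\<close>.\<close>

lemma AE_frequently_minimises_on_mean_set:
  assumes mean_set: "mean_set V E \<mu> = v ` {1..k}"
    and dim: "walk_genuinely_dimensional V E v k \<mu> (k - 1)"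
    and j: "j \<in> {1..k}"
  shows "AE \<omega> in P. \<exists>\<^sub>F n in sequentially. \<forall>w\<in>mean_set V E \<mu>.
           (\<Sum>i=1..n. sqdist (v j) (\<xi> i \<omega>)) \<le> (\<Sum>i=1..n. sqdist w (\<xi> i \<omega>))"
proof -
  define b where "b i = of_bool (i \<noteq> j) - (of_bool (1 \<noteq> j) :: int)" for i
  obtain F c where F: "finite F" "F \<subseteq> {s \<in> V. \<mu> s > 0}"
    and c: "\<And>l. l \<in> {1..k - 1} \<Longrightarrow>
      (\<Sum>s\<in>F. c s * real_of_int (walk_increment V E v k s l)) = real_of_int (b (l + 1))"
    using genuinely_dimensional_imp_increments_span[OF dim, of "\<lambda>l. b (l + 1)"] by blast
  have target: "(\<Sum>s\<in>F. c s * (sqdist (v i) s - sqdist (v 1) s)) = real_of_int (b i)" if i: "i \<in> {1..k}" for i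
  proof (cases "i = 1")
    case True
    then show ?thesis by (simp add: b_def)
  next
    case False
    then have l: "i - 1 \<in> {1..k - 1}" and [simp]: "i - 1 + 1 = i" using i by auto
    have "real_of_int (walk_increment V E v k s (i - 1)) = sqdist (v i) s - sqdist (v 1) s" for s
      using l by (simp add: walk_increment_def sqdist_def)
    then show ?thesis using c[OF l] by simp
  qed
  define I where "I = {1..k} - {j}"
  define g where "g i s = sqdist (v i) s - sqdist (v j) s" for i s
  have g_target: "(\<Sum>s\<in>F. c s * g i s) = 1" if i: "i \<in> I" for i
  proof -
    have "(\<Sum>s\<in>F. c s * g i s) = (\<Sum>s\<in>F. c s * (sqdist (v i) s - sqdist (v 1) s))
        - (\<Sum>s\<in>F. c s * (sqdist (v j) s - sqdist (v 1) s))"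
      by (simp add: g_def sum_subtractf[symmetric] algebra_simps)
    also have "\<dots> = 1"
      using i j by (simp add: target I_def b_def)
    finally show ?thesis .
  qed
  have vV: "v i \<in> V" if "i \<in> {1..k}" for i
    using mean_set that by (auto simp: mean_set_def)
  have g2: "integrable P (\<lambda>\<omega>. (g i (\<xi> 1 \<omega>))\<^sup>2)" if "i \<in> I" for i
    unfolding g_def using that j by (intro integrable_sqdist_difference_square vV) (auto simp: I_def)
  have int_g: "integrable P (\<lambda>\<omega>. g i (\<xi> 1 \<omega>))" if "i \<in> I" for i
    by (rule square_integrable_imp_integrable_1[OF _ g2[OF that]]) simp
  have g_mean: "expectation (\<lambda>\<omega>. g i (\<xi> 1 \<omega>)) = 0" if i: "i \<in> I" for i
  proof -
    have "v i \<in> mean_set V E \<mu>" "v j \<in> mean_set V E \<mu>"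
      using i j unfolding mean_set I_def by auto
    then have "mean_sqdist (v i) = mean_sqdist (v j)"
      by (simp add: mem_mean_set_iff antisym)
    then show ?thesis
      using i j integrable_sqdist[OF vV] by (simp add: g_def mean_sqdist_def I_def)
  qed
  define \<theta> where "\<theta> x = (\<Sum>s\<in>F. c s / \<mu> s * (indicator {s} x - \<mu> s))" for x
  note tilt = centred_indicator_combination[where c = c, OF refl F, folded \<theta>_def]
  have "AE \<omega> in P. \<exists>\<^sub>F n in sequentially. \<forall>i\<in>I. 0 \<le> (\<Sum>l=1..n. g i (\<xi> l \<omega>))"
  proof (rule AE_frequently_all_sums_nonneg[where \<theta> = \<theta>])
    show "expectation (\<lambda>\<omega>. \<theta> (\<xi> 1 \<omega>) * g i (\<xi> 1 \<omega>)) = 1" if "i \<in> I" for i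
      using tilt(3)[OF int_g[OF that] g_mean[OF that]] g_target[OF that] by simp
    show "finite I" by (simp add: I_def)
    show "\<bar>\<theta> x\<bar> \<le> (\<Sum>s\<in>F. \<bar>c s / \<mu> s\<bar> * (1 + \<bar>\<mu> s\<bar>))" for x
      by (rule tilt(2))
  qed (simp_all add: g2 g_mean tilt(1))
  then show ?thesis
  proof (rule eventually_mono)
    fix \<omega> assume "\<exists>\<^sub>F n in sequentially. \<forall>i\<in>I. 0 \<le> (\<Sum>l=1..n. g i (\<xi> l \<omega>))"
    then show "\<exists>\<^sub>F n in sequentially. \<forall>w\<in>mean_set V E \<mu>.
           (\<Sum>i=1..n. sqdist (v j) (\<xi> i \<omega>)) \<le> (\<Sum>i=1..n. sqdist w (\<xi> i \<omega>))"
    proof (rule frequently_elim1)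
      fix n assume n: "\<forall>i\<in>I. 0 \<le> (\<Sum>l=1..n. g i (\<xi> l \<omega>))"
      show "\<forall>w\<in>mean_set V E \<mu>. (\<Sum>i=1..n. sqdist (v j) (\<xi> i \<omega>)) \<le> (\<Sum>i=1..n. sqdist w (\<xi> i \<omega>))"
      proof
        fix w assume "w \<in> mean_set V E \<mu>"
        then obtain i where i: "i \<in> {1..k}" "w = v i" using mean_set by auto
        show "(\<Sum>i=1..n. sqdist (v j) (\<xi> i \<omega>)) \<le> (\<Sum>i=1..n. sqdist w (\<xi> i \<omega>))"
        proof (cases "i = j")
          case False
          then have "i \<in> I" using i by (simp add: I_def)
          then show ?thesis using n i by (simp add: g_def sum_subtractf)
        qed (use i in simp)
      qed
    qed
  qed
qed

end

lemma mem_limsup_set_iff: "x \<in> limsup A \<longleftrightarrow> (\<exists>\<^sub>F n in sequentially. x \<in> A n)"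
  for A :: "nat \<Rightarrow> 'a set"
  by (auto simp: limsup_INF_SUP frequently_sequentially)

theorem theoremB:
  fixes V :: "'v set" and E :: "'v set set"
    and P :: "'w measure" and \<xi> :: "nat \<Rightarrow> 'w \<Rightarrow> 'v"
    and v :: "nat \<Rightarrow> 'v" and k :: nat
  assumes "graph V E" and "locally_finite V E" and "graph_connected V E"
    and "prob_space P"
    and indep: "prob_space.indep_vars P (\<lambda>_. count_space V) \<xi> {1..}"
    and ident: "\<And>i. i \<ge> 1 \<Longrightarrow> distr P (count_space V) (\<xi> i) = distr P (count_space V) (\<xi> 1)"
    and "weight_totally_defined V E (distribution_of P (\<xi> 1))"
    and "k \<ge> 4"
    and "inj_on v {1..k}"
    and "mean_set V E (distribution_of P (\<xi> 1)) = v ` {1..k}"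
    and "walk_genuinely_dimensional V E v k (distribution_of P (\<xi> 1)) (k - 1)"
  shows "AE \<omega> in P. limsup (\<lambda>n. sample_mean_set V E (\<lambda>i. \<xi> i \<omega>) n)
                     = mean_set V E (distribution_of P (\<xi> 1))"
proof -
  interpret prob_space P by fact
  interpret random_vertex_sequence V E P \<xi>
    by unfold_locales (fact assms(2) assms(3) indep ident assms(7))+
  let ?M = "mean_set V E \<mu>"
  let ?S = "\<lambda>\<omega> n. sample_mean_set V E (\<lambda>i. \<xi> i \<omega>) n"
  have beats: "AE \<omega> in P. \<forall>x\<in>?M. \<forall>\<^sub>F n in sequentially. \<forall>u\<in>V - ?M.
      (\<Sum>i=1..n. sqdist x (\<xi> i \<omega>)) < (\<Sum>i=1..n. sqdist u (\<xi> i \<omega>))"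
  proof (rule AE_finite_allI)
    show "finite ?M" unfolding assms(10) by simp
  qed (rule AE_eventually_mean_set_beats_others)
  have minimal: "AE \<omega> in P. \<forall>j\<in>{1..k}. \<exists>\<^sub>F n in sequentially. \<forall>w\<in>?M.
      (\<Sum>i=1..n. sqdist (v j) (\<xi> i \<omega>)) \<le> (\<Sum>i=1..n. sqdist w (\<xi> i \<omega>))"
    by (rule AE_finite_allI[OF finite_atLeastAtMost])
       (rule AE_frequently_minimises_on_mean_set[OF assms(10,11)])
  from beats minimal AE_space show ?thesis
  proof eventually_elim
    case (elim \<omega>)
    note beats = elim(1)[rule_format] and minimal = elim(2)[rule_format]
    have S_iff: "u \<in> ?S \<omega> n \<longleftrightarrow>
        u \<in> V \<and> (\<forall>w\<in>V. (\<Sum>i=1..n. sqdist u (\<xi> i \<omega>)) \<le> (\<Sum>i=1..n. sqdist w (\<xi> i \<omega>)))"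
      if "n \<ge> 1" for u n
      by (rule mem_sample_mean_set_iff) (use that \<xi>_in_V elim(3) in auto)
    have M_sub: "?M \<subseteq> V" by (auto simp: mean_set_def)
    have "v 1 \<in> ?M" using assms(8,10) by auto
    have "x \<in> ?M" if x: "\<exists>\<^sub>F n in sequentially. x \<in> ?S \<omega> n" for x
    proof (rule ccontr)
      assume "x \<notin> ?M"
      have "\<forall>\<^sub>F n in sequentially. n \<ge> 1 \<and> (\<forall>u\<in>V - ?M.
          (\<Sum>i=1..n. sqdist (v 1) (\<xi> i \<omega>)) < (\<Sum>i=1..n. sqdist u (\<xi> i \<omega>)))"
        using beats[OF \<open>v 1 \<in> ?M\<close>] by (intro eventually_conj eventually_ge_at_top)
      with x have "\<exists>\<^sub>F n in sequentially. x \<in> ?S \<omega> n \<and> (n \<ge> 1 \<and> (\<forall>u\<in>V - ?M.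
          (\<Sum>i=1..n. sqdist (v 1) (\<xi> i \<omega>)) < (\<Sum>i=1..n. sqdist u (\<xi> i \<omega>))))"
        by (rule frequently_eventually_frequently)
      then obtain n where n: "x \<in> ?S \<omega> n" "n \<ge> 1" "\<forall>u\<in>V - ?M.
          (\<Sum>i=1..n. sqdist (v 1) (\<xi> i \<omega>)) < (\<Sum>i=1..n. sqdist u (\<xi> i \<omega>))"
        using frequently_ex by blast
      have "x \<in> V" "(\<Sum>i=1..n. sqdist x (\<xi> i \<omega>)) \<le> (\<Sum>i=1..n. sqdist (v 1) (\<xi> i \<omega>))"
        using n(1) M_sub \<open>v 1 \<in> ?M\<close> unfolding S_iff[OF n(2)] by auto
      moreover have "(\<Sum>i=1..n. sqdist (v 1) (\<xi> i \<omega>)) < (\<Sum>i=1..n. sqdist x (\<xi> i \<omega>))"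
        using n(3) \<open>x \<in> V\<close> \<open>x \<notin> ?M\<close> by blast
      ultimately show False by simp
    qed
    moreover have "\<exists>\<^sub>F n in sequentially. x \<in> ?S \<omega> n" if x: "x \<in> ?M" for x
    proof -
      obtain j where j: "j \<in> {1..k}" "x = v j" using x assms(10) by auto
      have "\<forall>\<^sub>F n in sequentially. n \<ge> 1 \<and> (\<forall>u\<in>V - ?M.
          (\<Sum>i=1..n. sqdist x (\<xi> i \<omega>)) < (\<Sum>i=1..n. sqdist u (\<xi> i \<omega>)))"
        using beats[OF x] by (intro eventually_conj eventually_ge_at_top)
      from frequently_eventually_frequently[OF minimal[OF j(1)] this]
      show ?thesis
      proof (rule frequently_elim1)
        fix n assume n: "(\<forall>w\<in>?M. (\<Sum>i=1..n. sqdist (v j) (\<xi> i \<omega>)) \<le> (\<Sum>i=1..n. sqdist w (\<xi> i \<omega>)))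
          \<and> n \<ge> 1 \<and> (\<forall>u\<in>V - ?M. (\<Sum>i=1..n. sqdist x (\<xi> i \<omega>)) < (\<Sum>i=1..n. sqdist u (\<xi> i \<omega>)))"
        have "(\<Sum>i=1..n. sqdist x (\<xi> i \<omega>)) \<le> (\<Sum>i=1..n. sqdist w (\<xi> i \<omega>))" if "w \<in> V" for w
          using n that j(2) by (cases "w \<in> ?M") (auto intro: less_imp_le)
        then show "x \<in> ?S \<omega> n"
          using x M_sub n by (subst S_iff) auto
      qed
    qed
    ultimately show ?case
      by (auto simp: mem_limsup_set_iff)
  qed
qed

end
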